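(* For every $L>0$, almost surely $$\limsup_{T\to\infty}\frac{|M_f(T)|}{\exp\big((L+o(1))\sqrt{\log\log T}\big)}\geq 1,$$ where $o(1)$ denotes some function of $T$ tending to $0$ as $T\to\infty$.
   Context: Steinhaus random multiplicative function: let $(f(p))_p$, indexed by the primes, be independent random variables each uniformly distributed on the unit circle in $\mathbb{C}$, and set $f(n)=\prod_{p^{v_p}\| n}f(p)^{v_p}$ for $n\in\mathbb{N}$. Put $M_f(T)=\sum_{n\leq T}f(n)/\sqrt n$. *)

theory Defs
  imports "HOL-Probability.Probability" "HOL-Number_Theory.Number_Theory"
begin

definition unif_circle :: "complex measure" where
  "unif_circle = distr (uniform_measure lborel {0..2 * pi}) borel cis"

definition steinhaus :: "'a measure \<Rightarrow> (nat \<Rightarrow> 'a \<Rightarrow> complex) \<Rightarrow> bool" where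
  "steinhaus M f \<longleftrightarrow>
     prob_space.indep_vars M (\<lambda>_. borel) f {p. prime p} \<and>
     (\<forall>p. prime p \<longrightarrow> distr M borel (f p) = unif_circle)"

text \<open>
  Only the values \<open>g p\<close> at primes are used: \<open>mult_ext g\<close> is the completely multiplicative
  function on the positive integers that agrees with \<open>g\<close> at the primes.
\<close>
definition mult_ext :: "(nat \<Rightarrow> complex) \<Rightarrow> nat \<Rightarrow> complex" where
  "mult_ext g n = (\<Prod>p\<in>prime_factors n. g p ^ multiplicity p n)"

definition weighted_sum :: "(nat \<Rightarrow> complex) \<Rightarrow> real \<Rightarrow> complex" where
  "weighted_sum g T = (\<Sum>n\<in>{1..nat \<lfloor>T\<rfloor>}. mult_ext g n / of_real (sqrt (real n)))"

end

theory Submission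
  imports Defs "HOL-Real_Asymp.Real_Asymp"
begin

text \<open>
  Let \<open>F y \<sigma>\<close> be the Euler product over the primes \<open>p \<le> y\<close> of the factors
  \<open>1 / (1 - f p / p powr (1/2 + \<sigma>))\<close>, where \<open>\<sigma> = 1 / m\<close> and \<open>y = 2 ^ m\<^sup>2\<close>. By Abel summation over the
  \<open>y\<close>-smooth numbers, \<open>\<bar>F y \<sigma>\<bar>\<close> is at most the maximum of \<open>\<bar>M\<^sub>f(n)\<bar>\<close> over \<open>n \<le> y\<close> plus a remainder from
  \<open>n > y\<close>. Since the values \<open>f n\<close> are orthonormal and \<open>y\<close> is so large in terms of \<open>\<sigma>\<close>, the expectation of
  the remainder is exponentially small in \<open>m\<close>. On the other hand \<open>ln \<bar>F y \<sigma>\<bar>\<close> is, up to a bounded error, a sum of independent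
  centred variables whose variance is at least of order \<open>ln m\<close>, hence of order \<open>ln (ln y)\<close>, so that for every \<open>K\<close> it
  exceeds \<open>K\<close> standard deviations with probability bounded below (exponential moments and the
  Paley-Zygmund inequality). Along a sparse sequence of \<open>m\<close> these events can be
  made to depend on disjoint blocks of primes, the primes below the current block contributing a
  negligible amount. Almost surely infinitely many of them occur, while the remainders are
  eventually small. As \<open>K\<close> is arbitrary, \<open>\<epsilon> = 0\<close> works.
\<close>

section \<open>Euler products over smooth numbers\<close>

text \<open>The condition \<open>n > 0\<close> excludes 0, whose set of prime factors is empty by
  convention; 1 is included.\<close>

definition smooth_numbers :: "nat set \<Rightarrow> nat set" where
  "smooth_numbers P = {n. n > 0 \<and> prime_factors n \<subseteq> P}"

text \<open>A prime outside \<open>prime_factors n\<close> has exponent 0. The index set thus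
  becomes independent of \<open>n\<close>, so that products for different \<open>n\<close> can be
  compared factor by factor.\<close>

lemma mult_ext_eq_prod:
  assumes "finite P" "\<And>p. p \<in> P \<Longrightarrow> prime p" "n \<in> smooth_numbers P"
  shows "mult_ext h n = (\<Prod>p\<in>P. h p ^ multiplicity p n)"
  unfolding mult_ext_def
proof (rule prod.mono_neutral_left)
  show "\<forall>p\<in>P - prime_factors n. h p ^ multiplicity p n = 1"
    using assms by (auto simp: smooth_numbers_def prime_factors_multiplicity)
qed (use assms in \<open>auto simp: smooth_numbers_def\<close>)

lemma norm_mult_ext:
  assumes "\<And>p. prime p \<Longrightarrow> norm (h p) = 1"
  shows "norm (mult_ext h n) = 1"
  unfolding mult_ext_def prod_norm[symmetric]
  by (rule prod.neutral) (auto simp: norm_power assms in_prime_factors_imp_prime)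

text \<open>This is unique factorisation. Taking exponent vectors from \<open>PiE\<close> fixes
  their values outside \<open>P\<close>, which makes the map injective.\<close>

lemma bij_betw_smooth_numbers:
  assumes "finite P" "\<And>p. p \<in> P \<Longrightarrow> prime p"
  shows "bij_betw (\<lambda>e. \<Prod>p\<in>P. p ^ e p) (PiE P (\<lambda>_. UNIV)) (smooth_numbers P)"
proof (rule bij_betw_byWitness[where f' = "\<lambda>n. restrict (\<lambda>p. multiplicity p n) P"])
  have mult: "multiplicity p (\<Prod>q\<in>P. q ^ e q) = e p" if "p \<in> P" for p and e :: "nat \<Rightarrow> nat"
    using multiplicity_prod_prime_powers[OF assms] assms(2) that by simp
  show "\<forall>e\<in>PiE P (\<lambda>_. UNIV). restrict (\<lambda>p. multiplicity p (\<Prod>p\<in>P. p ^ e p)) P = e"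
    using mult by (auto simp: fun_eq_iff PiE_def extensional_def)
  show "\<forall>n\<in>smooth_numbers P. (\<Prod>p\<in>P. p ^ restrict (\<lambda>p. multiplicity p n) P p) = n"
  proof
    fix n assume n: "n \<in> smooth_numbers P"
    have "(\<Prod>p\<in>P. p ^ multiplicity p n) = (\<Prod>p\<in>prime_factors n. p ^ multiplicity p n)"
      using n assms
      by (intro prod.mono_neutral_right)
         (auto simp: smooth_numbers_def prime_factors_multiplicity)
    also have "\<dots> = n"
      using n prod_prime_factors[of n] by (auto simp: smooth_numbers_def)
    finally show "(\<Prod>p\<in>P. p ^ restrict (\<lambda>p. multiplicity p n) P p) = n"
      by (simp cong: prod.cong)
  qed
  show "(\<lambda>e. \<Prod>p\<in>P. p ^ e p) ` PiE P (\<lambda>_. UNIV) \<subseteq> smooth_numbers P"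
  proof safe
    fix e :: "nat \<Rightarrow> nat"
    have pos: "(\<Prod>p\<in>P. p ^ e p) > 0"
      using assms(2) by (intro prod_pos) (auto simp: prime_gt_0_nat)
    moreover have "q \<in> P" if "q \<in> prime_factors (\<Prod>p\<in>P. p ^ e p)" for q
    proof -
      have "prime q" "q dvd (\<Prod>p\<in>P. p ^ e p)"
        using that by auto
      then have "\<exists>p\<in>P. q dvd p ^ e p"
        by (simp add: prime_dvd_prod_iff[OF assms(1)])
      then obtain p where "p \<in> P" "q dvd p ^ e p"
        by (elim bexE)
      then have "q dvd p"
        using prime_dvd_power_nat[OF \<open>prime q\<close>] by simp
      then show ?thesis
        using primes_dvd_imp_eq[OF \<open>prime q\<close> assms(2)[OF \<open>p \<in> P\<close>]] \<open>p \<in> P\<close> by simp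
    qed
    ultimately show "(\<Prod>p\<in>P. p ^ e p) \<in> smooth_numbers P"
      by (auto simp: smooth_numbers_def)
  qed
qed auto

text \<open>Multiplying out finitely many absolutely convergent geometric series gives a sum over
  exponent vectors, which is reindexed by smooth numbers. Extension by zero turns it into an
  ordinary series over the naturals, whose partial sums are used later.\<close>

lemma euler_product_finite:
  fixes h :: "nat \<Rightarrow> complex"
  assumes "finite P" "\<And>p. p \<in> P \<Longrightarrow> prime p" "\<And>p. p \<in> P \<Longrightarrow> norm (h p) < 1"
  defines "c \<equiv> (\<lambda>n. if n \<in> smooth_numbers P then mult_ext h n else 0)"
  shows "summable (\<lambda>n. norm (c n))" "c sums (\<Prod>p\<in>P. 1 / (1 - h p))"
proof -
  let ?E = "PiE P (\<lambda>_. UNIV :: nat set)"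
  let ?g = "\<lambda>e. \<Prod>p\<in>P. h p ^ e p"
  have geo: "((\<lambda>k. z ^ k) has_sum (1 / (1 - z))) UNIV" if "norm z < 1" for z :: complex
    using that geometric_sums[of z] by (intro norm_summable_imp_has_sum)
      (auto simp: norm_power intro: summable_geometric)
  have geo_abs: "((\<lambda>k. norm (z ^ k)) has_sum (1 / (1 - norm z))) UNIV" if "norm z < 1" for z :: complex
    using that geometric_sums[of "norm z"] by (intro norm_summable_imp_has_sum)
      (auto simp: norm_power intro: summable_geometric)
  have "infsum (\<lambda>e. \<Prod>p\<in>P. norm (h p ^ e p)) ?E = (\<Prod>p\<in>P. infsum (\<lambda>k. norm (h p ^ k)) UNIV)"
    using geo_abs assms(3)
    by (intro infsum_prod_PiE_abs[OF assms(1)]) (auto simp: summable_on_def)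
  also have "\<dots> = (\<Prod>p\<in>P. 1 / (1 - norm (h p)))"
    using geo_abs assms(3) by (intro prod.cong refl infsumI) auto
  \<comment> \<open>A non-summable family has \<open>infsum\<close> equal to 0, so a nonzero value
    already proves absolute summability.\<close>
  also have "\<dots> \<noteq> 0"
    using assms(1,3) by force
  finally have abs_E: "(\<lambda>e. norm (?g e)) summable_on ?E"
    using infsum_not_exists by (fastforce simp: prod_norm)
  have "infsum ?g ?E = (\<Prod>p\<in>P. infsum (\<lambda>k. h p ^ k) UNIV)"
    using geo_abs assms(3)
    by (intro infsum_prod_PiE_abs[OF assms(1)]) (auto simp: summable_on_def)
  also have "\<dots> = (\<Prod>p\<in>P. 1 / (1 - h p))"
    using geo assms(3) by (intro prod.cong refl infsumI) auto
  finally have sum_E: "(?g has_sum (\<Prod>p\<in>P. 1 / (1 - h p))) ?E"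
    using has_sum_infsum[OF abs_summable_summable[OF abs_E]] by metis
  have g_eq: "?g e = mult_ext h (\<Prod>p\<in>P. p ^ e p)" if "e \<in> ?E" for e
  proof -
    have "(\<Prod>p\<in>P. p ^ e p) \<in> smooth_numbers P"
      using bij_betwE[OF bij_betw_smooth_numbers[OF assms(1,2)]] that by auto
    then have "mult_ext h (\<Prod>p\<in>P. p ^ e p) = (\<Prod>q\<in>P. h q ^ multiplicity q (\<Prod>p\<in>P. p ^ e p))"
      using mult_ext_eq_prod assms(1,2) by blast
    also have "\<dots> = ?g e"
      using multiplicity_prod_prime_powers[OF assms(1)] assms(2)
      by (intro prod.cong refl) simp
    finally show ?thesis ..
  qed
  have "(mult_ext h has_sum (\<Prod>p\<in>P. 1 / (1 - h p))) (smooth_numbers P)"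
  proof (subst has_sum_reindex_bij_betw[OF bij_betw_smooth_numbers[OF assms(1,2)], symmetric])
    show "((\<lambda>e. mult_ext h (\<Prod>p\<in>P. p ^ e p)) has_sum (\<Prod>p\<in>P. 1 / (1 - h p))) ?E"
      using sum_E by (rule has_sum_cong[THEN iffD1, rotated]) (simp only: g_eq)
  qed (use assms in auto)
  then have "(c has_sum (\<Prod>p\<in>P. 1 / (1 - h p))) UNIV"
    by (subst has_sum_cong_neutral[where T = "smooth_numbers P" and g = "mult_ext h"]) (auto simp: c_def)
  then show "c sums (\<Prod>p\<in>P. 1 / (1 - h p))"
    by (rule has_sum_imp_sums)
  have "(\<lambda>n. norm (mult_ext h n)) summable_on smooth_numbers P"
  proof (subst summable_on_reindex_bij_betw[OF bij_betw_smooth_numbers[OF assms(1,2)], symmetric])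
    show "(\<lambda>e. norm (mult_ext h (\<Prod>p\<in>P. p ^ e p))) summable_on ?E"
      using abs_E by (rule summable_on_cong[THEN iffD1, rotated]) (simp only: g_eq)
  qed (use assms in auto)
  then have "(\<lambda>n. norm (c n)) summable_on UNIV"
    by (subst summable_on_cong_neutral[where T = "smooth_numbers P" and g = "\<lambda>n. norm (mult_ext h n)"])
       (auto simp: c_def)
  then show "summable (\<lambda>n. norm (c n))"
    by (rule summable_on_imp_summable)
qed

text \<open>The function \<open>n powr s\<close> is itself completely multiplicative. At
  \<open>n = 0\<close> the left side would be an empty product, hence 1, while the right side is
  0.\<close>

lemma mult_ext_powr:
  assumes "n > 0"
  shows "mult_ext (\<lambda>p. g p * of_real (real p powr s)) n = mult_ext g n * of_real (real n powr s)"
proof -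
  have "real n = real (\<Prod>p\<in>prime_factors n. p ^ multiplicity p n)"
    using prod_prime_factors[of n] assms by simp
  then have "real n powr s = (\<Prod>p\<in>prime_factors n. real p ^ multiplicity p n) powr s"
    by simp
  also have "\<dots> = (\<Prod>p\<in>prime_factors n. (real p powr s) ^ multiplicity p n)"
    unfolding prod_powr_distrib
  proof (rule prod.cong)
    fix p assume "p \<in> prime_factors n"
    then have "real p > 0"
      by (simp add: prime_gt_0_nat in_prime_factors_iff)
    then have "(real p ^ k) powr s = (real p powr s) ^ k" for k
      by (induction k) (auto simp: powr_mult)
    then show "(real p ^ multiplicity p n) powr s = (real p powr s) ^ multiplicity p n" .
  qed simp
  finally show ?thesis
    by (simp add: mult_ext_def power_mult_distrib prod.distrib)
qed

lemma partial_summation: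
  fixes c :: "nat \<Rightarrow> complex" and w :: "nat \<Rightarrow> real"
  shows "(\<Sum>n=1..N. c n * of_real (w n)) =
    (\<Sum>n=1..N. (\<Sum>j=1..n. c j) * of_real (w n - w (Suc n))) + (\<Sum>j=1..N. c j) * of_real (w (Suc N))"
  by (induction N) (auto simp: algebra_simps)

section \<open>Moments of the uniform distribution on the circle\<close>

lemma borel_measurable_cis [measurable]: "cis \<in> borel_measurable borel"
  by (intro borel_measurable_continuous_onI continuous_intros)

lemma integral_unif_circle:
  fixes g :: "complex \<Rightarrow> 'b :: {banach, second_countable_topology}"
  assumes [measurable]: "g \<in> borel_measurable borel"
  shows "integral\<^sup>L unif_circle g = (LINT t:{0..2*pi}|lborel. g (cis t)) /\<^sub>R (2 * pi)"
proof -
  have "integral\<^sup>L unif_circle g = integral\<^sup>L (uniform_measure lborel {0..2*pi}) (\<lambda>t. g (cis t))"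
    unfolding unif_circle_def by (rule integral_distr) auto
  also have "uniform_measure lborel {0..2*pi} = density lborel (\<lambda>x. ennreal (indicator {0..2*pi} x / (2*pi)))"
    unfolding uniform_measure_def
    by (rule density_cong) (auto simp: indicator_def divide_ennreal ennreal_divide_self simp flip: ennreal_1)
  also have "integral\<^sup>L \<dots> (\<lambda>t. g (cis t)) = (LINT t|lborel. (indicator {0..2*pi} t / (2*pi)) *\<^sub>R g (cis t))"
    by (rule integral_density) (auto simp: indicator_def)
  also have "\<dots> = (LINT t|lborel. (1 / (2*pi)) *\<^sub>R (indicator {0..2*pi} t *\<^sub>R g (cis t)))"
    by (rule Bochner_Integration.integral_cong) auto
  also have "\<dots> = (LINT t:{0..2*pi}|lborel. g (cis t)) /\<^sub>R (2 * pi)"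
    unfolding set_lebesgue_integral_def
    by (simp only: integral_scaleR_right inverse_eq_divide)
  finally show ?thesis .
qed

lemma AE_unif_circle: "AE z in unif_circle. norm z = 1"
  unfolding unif_circle_def by (subst AE_distr_iff) auto

lemma integral_cis_int:
  assumes "k \<noteq> (0::int)"
  shows "(LINT t:{0..2*pi}|lborel. cis (of_int k * t)) = 0"
proof -
  define F where "F t = cis (of_int k * t) / (\<i> * of_int k)" for t :: real
  have deriv: "(F has_vector_derivative cis (of_int k * t)) (at t within {0..2*pi})" for t
  proof -
    have "((\<lambda>z. exp (\<i> * of_int k * z) / (\<i> * of_int k)) has_field_derivative exp (\<i> * of_int k * of_real t)) (at (of_real t))"
      using assms by (auto intro!: derivative_eq_intros)
    from has_vector_derivative_real_field[OF this] show ?thesis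
      unfolding F_def by (simp add: cis_conv_exp mult.assoc o_def)
  qed
  have "(LINT t:{0..2*pi}|lborel. cis (of_int k * t)) = F (2*pi) - F 0"
    unfolding set_lebesgue_integral_def
    by (rule integral_FTC_atLeastAtMost[OF _ deriv]) (auto intro!: continuous_intros)
  also have "\<dots> = 0"
    using cis_multiple_2pi[of "of_int k"] by (simp add: F_def mult.commute)
  finally show ?thesis .
qed

text \<open>On the unit circle conjugation is inversion, so the integrand is the character of index
  \<open>a - b\<close>, and only the trivial character has nonzero mean.\<close>

lemma integral_unif_circle_power:
  "integral\<^sup>L unif_circle (\<lambda>z. z ^ a * cnj z ^ b) = (if a = b then 1 else 0)"
proof -
  have eq: "cis t ^ a * cnj (cis t) ^ b = cis (of_int (int a - int b) * t)" for t
    by (simp add: cis_cnj Complex.DeMoivre cis_mult algebra_simps)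
  have "integral\<^sup>L unif_circle (\<lambda>z. z ^ a * cnj z ^ b) =
      (LINT t:{0..2*pi}|lborel. cis (of_int (int a - int b) * t)) /\<^sub>R (2 * pi)"
    by (subst integral_unif_circle)
       (auto simp: eq intro!: borel_measurable_continuous_onI continuous_intros)
  also have "\<dots> = (if a = b then 1 else 0)"
    using integral_cis_int[of "int a - int b"]
    by (auto simp: set_lebesgue_integral_def scaleR_conv_of_real)
  finally show ?thesis .
qed

lemma prob_space_unif_circle: "prob_space unif_circle"
proof -
  interpret U: prob_space "uniform_measure lborel {0..2*pi}"
    by (rule prob_space_uniform_measure) auto
  show ?thesis
    unfolding unif_circle_def by (rule U.prob_space_distr) simp
qed

lemma sets_unif_circle [simp, measurable_cong]: "sets unif_circle = sets borel"
  and space_unif_circle [simp]: "space unif_circle = UNIV"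
  by (simp_all add: unif_circle_def)

section \<open>Exponential moments of the second-order logarithm of an Euler factor\<close>

text \<open>Upper bound: in the Lagrange remainder of order 3, \<open>exp s \<le> 3\<close> makes
  the cubic term at most half of the square. Lower bound: the remainder of order 4 is nonnegative
  and the cubic term costs at most a sixth of the square.\<close>

lemma exp_quadratic_bounds:
  fixes x :: real
  assumes "\<bar>x\<bar> \<le> 1"
  shows "exp x \<le> 1 + x + x\<^sup>2" "1 + x + x\<^sup>2 / 4 \<le> exp x"
proof -
  have cube: "\<bar>x ^ 3\<bar> \<le> x\<^sup>2"
    using power_decreasing[of 2 3 "\<bar>x\<bar>"] assms by (simp add: power_abs)
  obtain s where s: "\<bar>s\<bar> \<le> \<bar>x\<bar>" "exp x = (\<Sum>m<3. x ^ m / fact m) + exp s / fact 3 * x ^ 3"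
    using Maclaurin_exp_le[of x 3] by blast
  have "exp s \<le> 3"
    using s(1) assms exp_le order_trans[of "exp s" "exp 1" 3] by simp
  then have "\<bar>exp s * x ^ 3\<bar> \<le> 3 * x\<^sup>2"
    unfolding abs_mult using cube by (intro mult_mono) auto
  then show "exp x \<le> 1 + x + x\<^sup>2"
    using s(2) by (simp add: eval_nat_numeral)
  obtain r where r: "exp x = (\<Sum>m<4. x ^ m / fact m) + exp r / fact 4 * x ^ 4"
    using Maclaurin_exp_le[of x 4] by blast
  have "0 \<le> exp r / fact 4 * x ^ 4"
    by (simp add: zero_le_even_power)
  moreover have "(\<Sum>m<4. x ^ m / fact m) = 1 + x + x\<^sup>2 / 2 + x ^ 3 / 6"
    by (simp add: eval_nat_numeral)
  moreover have "- (x ^ 3) \<le> x\<^sup>2" "0 \<le> x\<^sup>2"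
    using cube by auto
  ultimately show "1 + x + x\<^sup>2 / 4 \<le> exp x"
    using r by linarith
qed

text \<open>The real part of the expansion of \<open>-ln (1 - a z)\<close> up to second order.\<close>
definition log_euler_approx :: "real \<Rightarrow> complex \<Rightarrow> real" where
  "log_euler_approx a z = a * Re z + a\<^sup>2 / 2 * Re (z\<^sup>2)"

lemma borel_measurable_log_euler_approx [measurable]: "log_euler_approx a \<in> borel_measurable borel"
  unfolding log_euler_approx_def
  by (intro borel_measurable_continuous_onI continuous_intros)

lemma abs_log_euler_approx_le:
  assumes "0 \<le> a" "a \<le> 1" "norm z = 1"
  shows "\<bar>log_euler_approx a z\<bar> \<le> 2 * a"
proof -
  have "\<bar>Re z\<bar> \<le> 1" "\<bar>Re (z\<^sup>2)\<bar> \<le> 1"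
    using abs_Re_le_cmod[of z] abs_Re_le_cmod[of "z\<^sup>2"] assms(3) by (auto simp: norm_power)
  then have "\<bar>a * Re z\<bar> \<le> a" "\<bar>a\<^sup>2 / 2 * Re (z\<^sup>2)\<bar> \<le> a\<^sup>2 / 2"
    using assms by (auto simp: abs_mult intro!: mult_left_le)
  moreover have "a\<^sup>2 \<le> a"
    using assms by (simp add: power2_eq_square mult_left_le)
  ultimately show ?thesis
    unfolding log_euler_approx_def using assms(1) by linarith
qed

lemma integral_unif_circle_Re_power:
  assumes "k > 0"
  shows "integral\<^sup>L unif_circle (\<lambda>z. Re (z ^ k)) = 0"
    and "integrable unif_circle (\<lambda>z. Re (z ^ k))"
proof -
  interpret prob_space unif_circle by (rule prob_space_unif_circle)
  have "AE z in unif_circle. norm (z ^ k) \<le> 1"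
    using AE_unif_circle by eventually_elim (simp add: norm_power)
  then have int: "integrable unif_circle (\<lambda>z. z ^ k)"
    by (rule integrable_const_bound)
       (auto intro!: borel_measurable_continuous_onI continuous_intros simp: measurable_def[symmetric]
         cong: measurable_cong_sets)
  show "integrable unif_circle (\<lambda>z. Re (z ^ k))"
    using int by simp
  show "integral\<^sup>L unif_circle (\<lambda>z. Re (z ^ k)) = 0"
    using integral_unif_circle_power[of k 0] int assms by (simp add: integral_Re)
qed

lemma moments_log_euler_approx:
  assumes "0 \<le> a" "a \<le> 1"
  shows "integral\<^sup>L unif_circle (log_euler_approx a) = 0"
    and "a\<^sup>2 / 2 \<le> integral\<^sup>L unif_circle (\<lambda>z. (log_euler_approx a z)\<^sup>2)"
    and "integral\<^sup>L unif_circle (\<lambda>z. (log_euler_approx a z)\<^sup>2) \<le> a\<^sup>2"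
proof -
  interpret prob_space unif_circle by (rule prob_space_unif_circle)
  note Re_int = integral_unif_circle_Re_power(2) integral_unif_circle_Re_power(2)[of 1, simplified]
  note Re_0 = integral_unif_circle_Re_power(1) integral_unif_circle_Re_power(1)[of 1, simplified]
  show "integral\<^sup>L unif_circle (log_euler_approx a) = 0"
    unfolding log_euler_approx_def using Re_int Re_0 by simp
  \<comment> \<open>The Fourier expansion of the square on the unit circle: for
    \<open>z = cis t\<close> the real parts of the powers of \<open>z\<close> are cosines of
    multiples of \<open>t\<close>. Only the constant term survives integration.\<close>
  define q where "q z = (a\<^sup>2 / 2 + a ^ 4 / 8) + (a\<^sup>2 / 2 * Re (z\<^sup>2) + a ^ 3 / 2 * Re z
      + a ^ 3 / 2 * Re (z ^ 3) + a ^ 4 / 8 * Re (z ^ 4))" for z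
  have "(log_euler_approx a z)\<^sup>2 = q z" if "norm z = 1" for z
  proof -
    have "(Re z)\<^sup>2 + (Im z)\<^sup>2 = 1"
      using that cmod_power2[of z] by simp
    then obtain t where "Re z = cos t" "Im z = sin t"
      using sincos_total_2pi by metis
    then have z: "z = cis t"
      by (simp add: complex_eq_iff)
    have c: "cos (2 * t) = 2 * (cos t)\<^sup>2 - 1" "cos (3 * t) = 4 * cos t ^ 3 - 3 * cos t"
      by (simp_all add: cos_double_cos cos_treble_cos)
    have "cos (4 * t) = 2 * (cos (2 * t))\<^sup>2 - 1"
      using cos_double_cos[of "2 * t"] by simp
    with c(1) have c4: "cos (4 * t) = 2 * (2 * (cos t)\<^sup>2 - 1)\<^sup>2 - 1"
      by simp
    show ?thesis
      unfolding q_def log_euler_approx_def z Complex.DeMoivre cis.sel of_nat_numeral c c4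
      by (simp add: power2_eq_square power3_eq_cube power4_eq_xxxx field_simps)
  qed
  then have "AE z in unif_circle. (log_euler_approx a z)\<^sup>2 = q z"
    using AE_unif_circle by (auto elim: eventually_mono)
  then have "integral\<^sup>L unif_circle (\<lambda>z. (log_euler_approx a z)\<^sup>2) = integral\<^sup>L unif_circle q"
  proof (intro integral_cong_AE)
    show "q \<in> borel_measurable unif_circle"
      unfolding q_def by (subst measurable_cong_sets[OF sets_unif_circle refl])
        (intro borel_measurable_continuous_onI continuous_intros)
  qed auto
  also have "\<dots> = a\<^sup>2 / 2 + a ^ 4 / 8"
    unfolding q_def using Re_int Re_0 prob_space by simp
  finally have eq: "integral\<^sup>L unif_circle (\<lambda>z. (log_euler_approx a z)\<^sup>2) = a\<^sup>2 / 2 + a ^ 4 / 8" .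
  moreover have "0 \<le> a ^ 4" "a ^ 4 \<le> a\<^sup>2" "0 \<le> a\<^sup>2"
    using assms power_decreasing[of 2 4 a] by auto
  ultimately show "a\<^sup>2 / 2 \<le> integral\<^sup>L unif_circle (\<lambda>z. (log_euler_approx a z)\<^sup>2)"
    "integral\<^sup>L unif_circle (\<lambda>z. (log_euler_approx a z)\<^sup>2) \<le> a\<^sup>2"
    by linarith+
qed

text \<open>The variable is at most \<open>2 * a\<close> in absolute value, so
  \<open>4 * t * a \<le> 1\<close> keeps both exponents in [-1, 1]. There the quadratic bounds for
  \<open>exp\<close> can be integrated, the linear term having mean zero. Mean and mean square are
  needed for Paley-Zygmund, hence the two parameters \<open>t\<close> and
  \<open>2 * t\<close>.\<close>

lemma mgf_log_euler_approx:
  assumes "0 \<le> a" "a \<le> 1" "0 \<le> t" "4 * t * a \<le> 1"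
  shows "exp (t\<^sup>2 * a\<^sup>2 / 16) \<le> integral\<^sup>L unif_circle (\<lambda>z. exp (t * log_euler_approx a z))"
    and "integral\<^sup>L unif_circle (\<lambda>z. exp (2 * t * log_euler_approx a z)) \<le> exp (4 * t\<^sup>2 * a\<^sup>2)"
proof -
  interpret prob_space unif_circle by (rule prob_space_unif_circle)
  let ?U = "log_euler_approx a"
  note mom = moments_log_euler_approx[OF assms(1,2)]
  have bnd: "AE z in unif_circle. \<bar>?U z\<bar> \<le> 2 * a"
    using AE_unif_circle abs_log_euler_approx_le[OF assms(1,2)] by (auto elim: eventually_mono)
  have bndt: "AE z in unif_circle. \<bar>t * ?U z\<bar> \<le> 1 \<and> \<bar>2 * t * ?U z\<bar> \<le> 1"
    using bnd
  proof eventually_elim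
    case (elim z)
    have "\<bar>t * ?U z\<bar> \<le> t * (2 * a)"
      unfolding abs_mult using elim assms(3) by (intro mult_mono) auto
    then show ?case
      using assms(4) by (auto simp: abs_mult)
  qed
  have int1: "integrable unif_circle ?U"
    using bnd by (intro integrable_const_bound[of _ "2 * a"]) auto
  have "AE z in unif_circle. norm ((?U z)\<^sup>2) \<le> (2 * a)\<^sup>2"
    using bnd by eventually_elim (use power_mono[of "\<bar>?U _\<bar>" "2 * a" 2] in simp)
  then have int2: "integrable unif_circle (\<lambda>z. (?U z)\<^sup>2)"
    by (intro integrable_const_bound) auto
  have intexp: "integrable unif_circle (\<lambda>z. exp (t * ?U z))" "integrable unif_circle (\<lambda>z. exp (2 * t * ?U z))"
    using bndt by (intro integrable_const_bound[of _ "exp 1"]; force elim: eventually_mono)+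
  have "t\<^sup>2 * a\<^sup>2 = (t * a)\<^sup>2"
    by (simp add: power_mult_distrib)
  also have "\<dots> \<le> 1"
    using assms by (intro power_le_one) auto
  finally have ta: "t\<^sup>2 * a\<^sup>2 \<le> 1" .
  \<comment> \<open>With \<open>x = t\<^sup>2 * a\<^sup>2 / 16 \<le> 1\<close> one has
    \<open>exp x \<le> 1 + x + x\<^sup>2 \<le> 1 + 2 * x\<close>, and \<open>2 * x\<close> is a
    quarter of \<open>t\<^sup>2\<close> times the lower bound for the second moment.\<close>
  have "exp (t\<^sup>2 * a\<^sup>2 / 16) \<le> 1 + t\<^sup>2 * a\<^sup>2 / 16 + (t\<^sup>2 * a\<^sup>2 / 16)\<^sup>2"
    using ta by (intro exp_bound) auto
  also have "(t\<^sup>2 * a\<^sup>2 / 16)\<^sup>2 \<le> t\<^sup>2 * a\<^sup>2 / 16"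
    using ta power_decreasing[of 1 2 "t\<^sup>2 * a\<^sup>2 / 16"] by simp
  finally have "exp (t\<^sup>2 * a\<^sup>2 / 16) \<le> 1 + t\<^sup>2 / 4 * (a\<^sup>2 / 2)"
    by (simp add: mult.commute)
  also have "\<dots> \<le> 1 + t\<^sup>2 / 4 * integral\<^sup>L unif_circle (\<lambda>z. (?U z)\<^sup>2)"
    using mom(2) by (intro add_left_mono mult_left_mono) auto
  also have "\<dots> = integral\<^sup>L unif_circle (\<lambda>z. 1 + t * ?U z + t\<^sup>2 / 4 * (?U z)\<^sup>2)"
    using int1 int2 mom(1) prob_space by simp
  also have "\<dots> \<le> integral\<^sup>L unif_circle (\<lambda>z. exp (t * ?U z))"
  proof (rule integral_mono_AE)
    show "AE z in unif_circle. 1 + t * ?U z + t\<^sup>2 / 4 * (?U z)\<^sup>2 \<le> exp (t * ?U z)"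
      using bndt by eventually_elim
        (use exp_quadratic_bounds(2)[of "t * ?U _"] in \<open>auto simp: power_mult_distrib\<close>)
  qed (use int1 int2 intexp in auto)
  finally show "exp (t\<^sup>2 * a\<^sup>2 / 16) \<le> integral\<^sup>L unif_circle (\<lambda>z. exp (t * ?U z))" .
  have "integral\<^sup>L unif_circle (\<lambda>z. exp (2 * t * ?U z)) \<le>
      integral\<^sup>L unif_circle (\<lambda>z. 1 + 2 * t * ?U z + 4 * t\<^sup>2 * (?U z)\<^sup>2)"
  proof (rule integral_mono_AE)
    show "AE z in unif_circle. exp (2 * t * ?U z) \<le> 1 + 2 * t * ?U z + 4 * t\<^sup>2 * (?U z)\<^sup>2"
      using bndt by eventually_elim
        (use exp_quadratic_bounds(1)[of "2 * t * ?U _"] in \<open>auto simp: power_mult_distrib\<close>)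
  qed (use int1 int2 intexp in auto)
  also have "\<dots> = 1 + 4 * t\<^sup>2 * integral\<^sup>L unif_circle (\<lambda>z. (?U z)\<^sup>2)"
    using int1 int2 mom(1) prob_space by simp
  also have "\<dots> \<le> 1 + 4 * t\<^sup>2 * a\<^sup>2"
    using mom(3) by (intro add_left_mono mult_left_mono) auto
  also have "\<dots> \<le> exp (4 * t\<^sup>2 * a\<^sup>2)"
    by (rule exp_ge_add_one_self)
  finally show "integral\<^sup>L unif_circle (\<lambda>z. exp (2 * t * ?U z)) \<le> exp (4 * t\<^sup>2 * a\<^sup>2)" .
qed

text \<open>Applied to \<open>Y = exp (t * X)\<close>, this turns bounds for exponential moments
  into a lower bound for the probability that \<open>X\<close> is large.\<close>

lemma (in prob_space) paley_zygmund:
  fixes Y :: "'a \<Rightarrow> real"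
  assumes int: "integrable M Y" "integrable M (\<lambda>x. (Y x)\<^sup>2)" and pos: "0 < expectation Y" "0 < expectation (\<lambda>x. (Y x)\<^sup>2)"
  shows "(expectation Y)\<^sup>2 / (4 * expectation (\<lambda>x. (Y x)\<^sup>2)) \<le> prob {x \<in> space M. expectation Y / 2 \<le> Y x}"
proof -
  define \<mu> E where "\<mu> = expectation Y" and "E = expectation (\<lambda>x. (Y x)\<^sup>2)"
  define c where "c = \<mu> / (2 * E)"
  have c: "c > 0"
    using pos by (simp add: c_def \<mu>_def E_def)
  have [measurable]: "Y \<in> borel_measurable M"
    using int(1) by simp
  let ?A = "{x \<in> space M. \<mu> / 2 \<le> Y x}"
  have le: "Y x \<le> \<mu> / 2 + (c / 2 * (Y x)\<^sup>2 + indicator ?A x * (1 / (2 * c)))" if "x \<in> space M" for x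
  proof (cases "\<mu> / 2 \<le> Y x")
    case True
    \<comment> \<open>AM-GM instead of Cauchy-Schwarz: \<open>Y \<le> (c Y\<^sup>2 + 1 / c) / 2\<close>, with \<open>c\<close> chosen optimally above\<close>
    have "0 \<le> (c * Y x - 1)\<^sup>2 / (2 * c)"
      using c by simp
    also have "\<dots> = c / 2 * (Y x)\<^sup>2 + 1 / (2 * c) - Y x"
      using c by (simp add: field_simps power2_eq_square)
    finally show ?thesis
      using True that pos(1) by (simp add: \<mu>_def)
  next
    case False
    moreover have "0 \<le> c / 2 * (Y x)\<^sup>2"
      using c by simp
    ultimately show ?thesis by simp
  qed
  have int': "integrable M (\<lambda>x. indicator ?A x * (1 / (2 * c)))"
    by (intro integrable_mult_left integrable_real_indicator) (auto simp: emeasure_eq_measure)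
  have "\<mu> \<le> expectation (\<lambda>x. \<mu> / 2 + (c / 2 * (Y x)\<^sup>2 + indicator ?A x * (1 / (2 * c))))"
    using int int' by (subst \<mu>_def, intro integral_mono le Bochner_Integration.integrable_add integrable_mult_right) auto
  also have "\<dots> = \<mu> / 2 + (c / 2 * E + prob ?A * (1 / (2 * c)))"
    using int int' by (simp add: E_def prob_space)
  finally have "c * \<mu> \<le> c * (\<mu> / 2 + (c / 2 * E + prob ?A * (1 / (2 * c))))"
    using c by (intro mult_left_mono) auto
  also have "c * (\<mu> / 2 + (c / 2 * E + prob ?A * (1 / (2 * c)))) = c * \<mu> / 2 + c\<^sup>2 * E / 2 + prob ?A / 2"
    using c by (simp add: field_simps power2_eq_square)
  finally have "c * \<mu> - c\<^sup>2 * E \<le> prob ?A"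
    by simp
  also have "c * \<mu> - c\<^sup>2 * E = \<mu>\<^sup>2 / (4 * E)"
    using pos(2) by (simp add: c_def E_def[symmetric] field_simps power2_eq_square)
  finally show ?thesis
    by (simp add: \<mu>_def E_def)
qed

section \<open>Steinhaus variables\<close>

context prob_space
begin

lemma steinhaus_measurable:
  assumes "steinhaus M f" "prime p"
  shows "f p \<in> borel_measurable M"
  using assms by (auto simp: steinhaus_def indep_vars_def)

lemma steinhaus_expectation:
  fixes g :: "complex \<Rightarrow> 'b :: {banach, second_countable_topology}"
  assumes "steinhaus M f" "prime p" "g \<in> borel_measurable borel"
  shows "expectation (\<lambda>\<omega>. g (f p \<omega>)) = integral\<^sup>L unif_circle g"
  using assms integral_distr[OF steinhaus_measurable[OF assms(1,2)] assms(3)]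
  by (simp add: steinhaus_def)

text \<open>There are only countably many primes, so a single null set serves for all of
  them.\<close>

lemma steinhaus_AE_norm:
  assumes "steinhaus M f"
  shows "AE \<omega> in M. \<forall>p. prime p \<longrightarrow> norm (f p \<omega>) = 1"
  unfolding AE_all_countable
proof
  fix p
  show "AE \<omega> in M. prime p \<longrightarrow> norm (f p \<omega>) = 1"
  proof (cases "prime p")
    case True
    have eq: "distr M borel (f p) = unif_circle"
      using assms True by (simp add: steinhaus_def)
    have "AE z in distr M borel (f p). norm z = 1"
      unfolding eq by (rule AE_unif_circle)
    then show ?thesis
      using steinhaus_measurable[OF assms True] by (subst (asm) AE_distr_iff) auto
  qed simp
qed

lemma steinhaus_indep_compose:
  fixes g :: "nat \<Rightarrow> complex \<Rightarrow> 'b :: topological_space"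
  assumes "steinhaus M f" "\<And>p. p \<in> P \<Longrightarrow> prime p" "\<And>p. p \<in> P \<Longrightarrow> g p \<in> borel_measurable borel"
  shows "indep_vars (\<lambda>_. borel) (\<lambda>p \<omega>. g p (f p \<omega>)) P"
proof -
  have "indep_vars (\<lambda>_. borel) f {p. prime p}"
    using assms(1) unfolding steinhaus_def by blast
  then have "indep_vars (\<lambda>_. borel) f P"
    by (rule indep_vars_subset) (use assms(2) in blast)
  then show ?thesis
    by (rule indep_vars_compose2) (use assms(3) in auto)
qed

text \<open>Independence factorises the expectation. A bound on the unit circle suffices for
  integrability, because the variables lie there almost surely.\<close>

lemma steinhaus_expectation_prod:
  fixes g :: "nat \<Rightarrow> complex \<Rightarrow> 'b :: {real_normed_field, banach, second_countable_topology}"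
  assumes "steinhaus M f" "finite P" "\<And>p. p \<in> P \<Longrightarrow> prime p" "\<And>p. p \<in> P \<Longrightarrow> g p \<in> borel_measurable borel"
    and bnd: "\<And>p z. p \<in> P \<Longrightarrow> norm z = 1 \<Longrightarrow> norm (g p z) \<le> B"
  shows "expectation (\<lambda>\<omega>. \<Prod>p\<in>P. g p (f p \<omega>)) = (\<Prod>p\<in>P. integral\<^sup>L unif_circle (g p))"
    and "integrable M (\<lambda>\<omega>. \<Prod>p\<in>P. g p (f p \<omega>))"
proof -
  have int: "integrable M (\<lambda>\<omega>. g p (f p \<omega>))" if "p \<in> P" for p
  proof (rule integrable_const_bound)
    show "AE \<omega> in M. norm (g p (f p \<omega>)) \<le> B"
      using steinhaus_AE_norm[OF assms(1)] by eventually_elim (use bnd that assms(3) in auto)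
    show "(\<lambda>\<omega>. g p (f p \<omega>)) \<in> borel_measurable M"
      using assms(4)[OF that] steinhaus_measurable[OF assms(1) assms(3)[OF that]] by measurable
  qed
  note ind = steinhaus_indep_compose[OF assms(1,3,4)]
  show "expectation (\<lambda>\<omega>. \<Prod>p\<in>P. g p (f p \<omega>)) = (\<Prod>p\<in>P. integral\<^sup>L unif_circle (g p))"
    using indep_vars_lebesgue_integral[OF assms(2) ind int]
      steinhaus_expectation[OF assms(1) assms(3) assms(4)] by simp
  show "integrable M (\<lambda>\<omega>. \<Prod>p\<in>P. g p (f p \<omega>))"
    using indep_vars_integrable[OF assms(2) ind int] .
qed

section \<open>Orthogonality and second moments\<close>

lemma measurable_mult_ext:
  assumes "steinhaus M f"
  shows "(\<lambda>\<omega>. mult_ext (\<lambda>p. f p \<omega>) n) \<in> borel_measurable M"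
  unfolding mult_ext_def
  by (intro borel_measurable_prod borel_measurable_power steinhaus_measurable[OF assms])
     (auto simp: in_prime_factors_imp_prime)

text \<open>The expectation factorises over the primes dividing \<open>i\<close> or
  \<open>j\<close>. If \<open>i\<close> and \<open>j\<close> differ, some prime has different
  multiplicities in them, and its factor vanishes.\<close>

lemma steinhaus_orthogonal:
  assumes "steinhaus M f" "i > 0" "j > 0"
  shows "expectation (\<lambda>\<omega>. mult_ext (\<lambda>p. f p \<omega>) i * cnj (mult_ext (\<lambda>p. f p \<omega>) j)) = (if i = j then 1 else 0)"
    and "integrable M (\<lambda>\<omega>. mult_ext (\<lambda>p. f p \<omega>) i * cnj (mult_ext (\<lambda>p. f p \<omega>) j))"
proof -
  define Q where "Q = prime_factors i \<union> prime_factors j"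
  define g where "g p z = z ^ multiplicity p i * cnj z ^ multiplicity p j" for p z
  have Q: "finite Q" "\<And>p. p \<in> Q \<Longrightarrow> prime p" "i \<in> smooth_numbers Q" "j \<in> smooth_numbers Q"
    using assms(2,3) by (auto simp: Q_def smooth_numbers_def)
  have eq: "mult_ext h i * cnj (mult_ext h j) = (\<Prod>p\<in>Q. g p (h p))" for h
    using Q by (simp add: mult_ext_eq_prod[of Q] g_def prod.distrib)
  have g: "g p \<in> borel_measurable borel" for p
    unfolding g_def by (intro borel_measurable_continuous_onI continuous_intros)
  have bnd: "norm (g p z) \<le> 1" if "norm z = 1" for p z
    using that by (simp add: g_def norm_mult norm_power)
  note prod = steinhaus_expectation_prod[OF assms(1) Q(1,2) g bnd]
  show "integrable M (\<lambda>\<omega>. mult_ext (\<lambda>p. f p \<omega>) i * cnj (mult_ext (\<lambda>p. f p \<omega>) j))"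
    unfolding eq by (rule prod(2))
  have "expectation (\<lambda>\<omega>. mult_ext (\<lambda>p. f p \<omega>) i * cnj (mult_ext (\<lambda>p. f p \<omega>) j)) =
      (\<Prod>p\<in>Q. if multiplicity p i = multiplicity p j then 1 else 0)"
    unfolding eq by (subst prod(1)) (simp_all add: g_def[abs_def] integral_unif_circle_power)
  also have "\<dots> = (if i = j then 1 else 0)"
  proof (cases "i = j")
    case False
    then obtain p where "prime p" "multiplicity p i \<noteq> multiplicity p j"
      using multiplicity_eq_nat[OF assms(2,3)] by blast
    then have "p \<in> Q"
      by (auto simp: Q_def prime_factors_multiplicity)
    then show ?thesis
      using False Q(1) \<open>multiplicity p i \<noteq> multiplicity p j\<close> by (auto intro!: prod_zero)
  qed simp
  finally show "expectation (\<lambda>\<omega>. mult_ext (\<lambda>p. f p \<omega>) i * cnj (mult_ext (\<lambda>p. f p \<omega>) j)) = (if i = j then 1 else 0)" .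
qed

text \<open>Parseval's identity: after expanding the square, orthogonality removes the off-diagonal
  terms.\<close>

lemma steinhaus_second_moment:
  fixes c :: "nat \<Rightarrow> real"
  assumes "steinhaus M f" "finite J" "\<And>j. j \<in> J \<Longrightarrow> j > 0"
  shows "expectation (\<lambda>\<omega>. (norm (\<Sum>j\<in>J. mult_ext (\<lambda>p. f p \<omega>) j * c j))\<^sup>2) = (\<Sum>j\<in>J. (c j)\<^sup>2)"
    and "integrable M (\<lambda>\<omega>. (norm (\<Sum>j\<in>J. mult_ext (\<lambda>p. f p \<omega>) j * c j))\<^sup>2)"
proof -
  let ?F = "\<lambda>j \<omega>. mult_ext (\<lambda>p. f p \<omega>) j"
  have eq: "complex_of_real ((norm (\<Sum>j\<in>J. ?F j \<omega> * c j))\<^sup>2) =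
      (\<Sum>i\<in>J. \<Sum>j\<in>J. of_real (c i * c j) * (?F i \<omega> * cnj (?F j \<omega>)))" for \<omega>
    unfolding complex_norm_square by (simp add: sum_product mult_ac)
  have int: "integrable M (\<lambda>\<omega>. \<Sum>i\<in>J. \<Sum>j\<in>J. of_real (c i * c j) * (?F i \<omega> * cnj (?F j \<omega>)))"
    using steinhaus_orthogonal(2)[OF assms(1)] assms(3)
    by (intro Bochner_Integration.integrable_sum integrable_mult_right) auto
  then have int': "integrable M (\<lambda>\<omega>. complex_of_real ((norm (\<Sum>j\<in>J. ?F j \<omega> * c j))\<^sup>2))"
    by (simp only: eq)
  then show int_real: "integrable M (\<lambda>\<omega>. (norm (\<Sum>j\<in>J. ?F j \<omega> * c j))\<^sup>2)"
    by (simp only: complex_of_real_integrable_eq)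
  have "complex_of_real (expectation (\<lambda>\<omega>. (norm (\<Sum>j\<in>J. ?F j \<omega> * c j))\<^sup>2)) =
      expectation (\<lambda>\<omega>. \<Sum>i\<in>J. \<Sum>j\<in>J. of_real (c i * c j) * (?F i \<omega> * cnj (?F j \<omega>)))"
    unfolding integral_complex_of_real[symmetric] by (simp only: eq)
  also have "\<dots> = (\<Sum>i\<in>J. \<Sum>j\<in>J. of_real (c i * c j) * (if i = j then 1 else 0))"
    using steinhaus_orthogonal[OF assms(1)] assms(3)
    by (subst Bochner_Integration.integral_sum, (intro Bochner_Integration.integrable_sum integrable_mult_right; simp))
       (intro sum.cong refl, subst Bochner_Integration.integral_sum, auto)
  also have "\<dots> = of_real (\<Sum>j\<in>J. (c j)\<^sup>2)"
    using assms(2) by (simp add: if_distrib[where f = "\<lambda>x. _ * x"] sum.delta power2_eq_square cong: if_cong)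
  finally show "expectation (\<lambda>\<omega>. (norm (\<Sum>j\<in>J. ?F j \<omega> * c j))\<^sup>2) = (\<Sum>j\<in>J. (c j)\<^sup>2)"
    using of_real_eq_iff by blast
qed

text \<open>Paley-Zygmund is applied to \<open>Y = exp (t * X)\<close> with \<open>t\<close> scaled
  so that \<open>t\<^sup>2 * V = l\<^sup>2\<close>. Then the mean of \<open>Y\<close> is at least
  \<open>exp (l\<^sup>2 / 16)\<close> and its mean square at most
  \<open>exp (4 * l\<^sup>2)\<close>, so the resulting probability depends on \<open>K\<close>
  alone. The lower bound on the standard deviation says \<open>4 * t \<le> 1\<close>, which the
  moment bounds require.\<close>

lemma steinhaus_large_deviation:
  assumes st: "steinhaus M f" and P: "finite P" "\<And>p. p \<in> P \<Longrightarrow> prime p"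
    and a: "\<And>p. p \<in> P \<Longrightarrow> 0 \<le> a p \<and> a p \<le> 1"
    and K: "0 \<le> K" "64 * (K + 1) \<le> sqrt (\<Sum>p\<in>P. (a p)\<^sup>2)"
  shows "exp (- (4 * (16 * (K + 1))\<^sup>2)) / 4 \<le>
    prob {\<omega> \<in> space M. K * sqrt (\<Sum>p\<in>P. (a p)\<^sup>2) \<le> (\<Sum>p\<in>P. log_euler_approx (a p) (f p \<omega>))}"
proof -
  define V where "V = (\<Sum>p\<in>P. (a p)\<^sup>2)"
  \<comment> \<open>Chosen so that \<open>l\<^sup>2 / 16 = l * (K + 1)\<close>. This exceeds
    \<open>l * K\<close> by \<open>l\<close>, which is more than enough to pay for the factor 1/2 in
    Paley-Zygmund, bounded below by \<open>exp (-1)\<close>.\<close>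
  define l where "l = 16 * (K + 1)"
  define t where "t = l / sqrt V"
  define X where "X \<omega> = (\<Sum>p\<in>P. log_euler_approx (a p) (f p \<omega>))" for \<omega>
  define Y where "Y \<omega> = exp (t * X \<omega>)" for \<omega>
  have l: "l \<ge> 16"
    using K(1) by (simp add: l_def)
  have sV: "4 * l \<le> sqrt V" "sqrt V > 0" "V > 0"
  proof -
    show "4 * l \<le> sqrt V"
      using K by (simp add: l_def V_def)
    then show "sqrt V > 0"
      using l by linarith
    then show "V > 0"
      by simp
  qed
  have t: "t > 0" "4 * t \<le> 1" "t\<^sup>2 * V = l\<^sup>2"
    using sV l by (auto simp: t_def field_simps power_divide)
  have ta: "4 * t * a p \<le> 1" if "p \<in> P" for p
    using mult_mono[of "4 * t" 1 "a p" 1] t a[OF that] by simp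
  have bnd: "norm (exp (s * log_euler_approx (a p) z)) \<le> exp (2 * s)"
    if "p \<in> P" "norm z = 1" "s \<ge> 0" for p z s
  proof -
    have "log_euler_approx (a p) z \<le> 2"
      using abs_log_euler_approx_le[of "a p" z] a that by fastforce
    then have "s * log_euler_approx (a p) z \<le> s * 2"
      using that(3) by (rule mult_left_mono)
    then show ?thesis
      by (simp add: mult.commute)
  qed
  have expU: "(\<lambda>z. exp (s * log_euler_approx b z)) \<in> borel_measurable borel" for s b
    by measurable
  have Y_eq: "Y \<omega> = (\<Prod>p\<in>P. exp (t * log_euler_approx (a p) (f p \<omega>)))" for \<omega>
    by (simp add: Y_def X_def sum_distrib_left exp_sum P(1))
  have Y2_eq: "(Y \<omega>)\<^sup>2 = (\<Prod>p\<in>P. exp (2 * t * log_euler_approx (a p) (f p \<omega>)))" for \<omega>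
    unfolding Y_eq prod_power_distrib by (simp add: exp_double[symmetric] mult.assoc)
  have Y1: "expectation Y = (\<Prod>p\<in>P. integral\<^sup>L unif_circle (\<lambda>z. exp (t * log_euler_approx (a p) z)))"
    "integrable M Y"
    using t(1) steinhaus_expectation_prod[where g = "\<lambda>p z. exp (t * log_euler_approx (a p) z)", OF st P expU bnd]
    by (simp_all add: Y_eq[abs_def])
  have Y2: "expectation (\<lambda>\<omega>. (Y \<omega>)\<^sup>2) =
      (\<Prod>p\<in>P. integral\<^sup>L unif_circle (\<lambda>z. exp (2 * t * log_euler_approx (a p) z)))"
    "integrable M (\<lambda>\<omega>. (Y \<omega>)\<^sup>2)"
    using t(1) steinhaus_expectation_prod[where g = "\<lambda>p z. exp (2 * t * log_euler_approx (a p) z)", OF st P expU bnd]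
    by (simp_all add: Y2_eq[abs_def])
  have "exp (l\<^sup>2 / 16) = (\<Prod>p\<in>P. exp (t\<^sup>2 * (a p)\<^sup>2 / 16))"
    by (simp add: exp_sum[OF P(1), symmetric] t(3)[symmetric] V_def sum_distrib_left sum_divide_distrib)
  also have "\<dots> \<le> expectation Y"
    unfolding Y1(1)
  proof (intro prod_mono conjI)
    fix p assume "p \<in> P"
    with a t(1) ta show "exp (t\<^sup>2 * (a p)\<^sup>2 / 16) \<le> integral\<^sup>L unif_circle (\<lambda>z. exp (t * log_euler_approx (a p) z))"
      by (intro mgf_log_euler_approx(1)) auto
  qed simp
  finally have EY: "exp (l\<^sup>2 / 16) \<le> expectation Y" .
  have "expectation (\<lambda>\<omega>. (Y \<omega>)\<^sup>2) \<le> (\<Prod>p\<in>P. exp (4 * t\<^sup>2 * (a p)\<^sup>2))"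
    unfolding Y2(1)
  proof (intro prod_mono conjI)
    fix p assume "p \<in> P"
    with a t(1) ta show "integral\<^sup>L unif_circle (\<lambda>z. exp (2 * t * log_euler_approx (a p) z)) \<le> exp (4 * t\<^sup>2 * (a p)\<^sup>2)"
      by (intro mgf_log_euler_approx(2)) auto
  qed (simp add: integral_nonneg)
  also have "\<dots> = exp (4 * l\<^sup>2)"
    by (simp add: exp_sum[OF P(1), symmetric] t(3)[symmetric] V_def sum_distrib_left mult.assoc)
  finally have EY2: "expectation (\<lambda>\<omega>. (Y \<omega>)\<^sup>2) \<le> exp (4 * l\<^sup>2)" .
  have EY_ge1: "1 \<le> expectation Y"
    by (rule order_trans[OF _ EY]) simp
  have EY2_pos: "0 < expectation (\<lambda>\<omega>. (Y \<omega>)\<^sup>2)"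
  proof -
    have "(expectation Y)\<^sup>2 \<le> expectation (\<lambda>\<omega>. (Y \<omega>)\<^sup>2)"
      using variance_positive[of Y] variance_eq[OF Y1(2) Y2(2)] by simp
    then show ?thesis
      using EY_ge1 one_le_power[of "expectation Y" 2] by linarith
  qed
  have X_meas: "X \<in> borel_measurable M"
    unfolding X_def using P
    by (intro borel_measurable_sum measurable_compose[OF steinhaus_measurable[OF st]]) auto
  have "exp (- (4 * l\<^sup>2)) / 4 = 1 / (4 * exp (4 * l\<^sup>2))"
    by (simp add: exp_minus field_simps)
  also have "\<dots> \<le> (expectation Y)\<^sup>2 / (4 * expectation (\<lambda>\<omega>. (Y \<omega>)\<^sup>2))"
    using EY_ge1 EY2 EY2_pos by (intro frac_le) (auto simp: one_le_power)
  also have "\<dots> \<le> prob {\<omega> \<in> space M. expectation Y / 2 \<le> Y \<omega>}"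
    using EY_ge1 EY2_pos by (intro paley_zygmund Y1 Y2) auto
  also have "\<dots> \<le> prob {\<omega> \<in> space M. K * sqrt V \<le> X \<omega>}"
  proof (intro finite_measure_mono)
    show "{\<omega> \<in> space M. expectation Y / 2 \<le> Y \<omega>} \<subseteq> {\<omega> \<in> space M. K * sqrt V \<le> X \<omega>}"
    proof safe
      fix \<omega> assume "expectation Y / 2 \<le> Y \<omega>"
      with EY have "exp (l\<^sup>2 / 16) \<le> 2 * exp (t * X \<omega>)"
        by (simp add: Y_def)
      also have "\<dots> \<le> exp 1 * exp (t * X \<omega>)"
        using exp_ge_add_one_self[of 1] by (intro mult_right_mono) auto
      finally have "l\<^sup>2 / 16 - 1 \<le> t * X \<omega>"
        by (simp add: exp_add[symmetric])
      moreover have "l * K \<le> l\<^sup>2 / 16 - 1"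
        using l by (simp add: l_def power2_eq_square field_simps)
      ultimately have "l * K \<le> t * X \<omega>"
        by linarith
      then have "l * (K * sqrt V) \<le> l * X \<omega>"
        using sV by (simp add: t_def field_simps)
      then show "K * sqrt V \<le> X \<omega>"
        using l by simp
    qed
    show "{\<omega> \<in> space M. K * sqrt V \<le> X \<omega>} \<in> events"
      using X_meas by measurable
  qed
  finally show ?thesis
    by (simp add: V_def l_def X_def)
qed

end

section \<open>Bounds for the Euler product\<close>

text \<open>The difference of the two sides has derivative \<open>x ^ 3 / (1 - x)\<close>, which has
  the sign of \<open>x\<close>, so its minimum is at 0. Negative \<open>u\<close> are covered too,
  as the next lemma requires.\<close>

lemma ln_one_minus_le_cubic:
  fixes u :: real
  assumes "u < 1"
  shows "u + u\<^sup>2 / 2 + u ^ 3 / 3 \<le> - ln (1 - u)"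
proof -
  define \<phi> where "\<phi> x = - ln (1 - x) - (x + x\<^sup>2 / 2 + x ^ 3 / 3)" for x :: real
  have deriv: "(\<phi> has_real_derivative x ^ 3 / (1 - x)) (at x)" if "x < 1" for x
    unfolding \<phi>_def using that
    by (auto intro!: derivative_eq_intros simp: field_simps power2_eq_square power3_eq_cube)
  have "\<phi> 0 \<le> \<phi> u"
  proof (cases "u \<ge> 0")
    case True
    then show ?thesis
    proof (rule DERIV_nonneg_imp_nondecreasing)
      fix x assume x: "0 \<le> x" "x \<le> u"
      with assms have "0 \<le> x ^ 3 / (1 - x)"
        by simp
      with x assms deriv[of x] show "\<exists>y. (\<phi> has_real_derivative y) (at x) \<and> 0 \<le> y"
        by auto
    qed
  next
    case False
    then have "u \<le> 0"
      by simp
    then show ?thesis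
    proof (rule DERIV_nonpos_imp_nonincreasing)
      fix x assume x: "u \<le> x" "x \<le> 0"
      then have "x ^ 3 / (1 - x) \<le> 0"
        by (intro divide_nonpos_pos) (auto simp: power3_eq_cube mult_nonneg_nonpos mult_nonpos_nonpos)
      with x deriv[of x] show "\<exists>y. (\<phi> has_real_derivative y) (at x) \<and> y \<le> 0"
        by auto
    qed
  qed
  then show ?thesis
    by (simp add: \<phi>_def)
qed

text \<open>The squared norm of \<open>1 - z * a\<close> is \<open>1 - u\<close>. In the cubic
  bound, \<open>u + u\<^sup>2 / 2\<close> reproduces twice the approximation up to a loss of at most
  \<open>2 * a ^ 3\<close>, and \<open>\<bar>u\<bar> \<le> 3 * a\<close> costs at most
  \<open>9 * a ^ 3\<close> more; 6 exceeds half of 11.\<close>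

lemma log_euler_factor_ge:
  assumes "0 \<le> a" "a < 1" "norm z = 1"
  shows "log_euler_approx a z - 6 * a ^ 3 \<le> - ln (norm (1 - z * of_real a))"
proof -
  define u where "u = 2 * (a * Re z) - a\<^sup>2"
  have z: "(Re z)\<^sup>2 + (Im z)\<^sup>2 = 1"
    using assms(3) cmod_power2[of z] by simp
  have "norm (z * of_real a) < 1"
    using assms by (simp add: norm_mult)
  then have pos: "norm (1 - z * of_real a) > 0"
    by auto
  have "(norm (1 - z * of_real a))\<^sup>2 = 1 - 2 * (a * Re z) + a\<^sup>2 * ((Re z)\<^sup>2 + (Im z)\<^sup>2)"
    unfolding cmod_power2 by (simp add: power2_eq_square algebra_simps)
  then have sq: "(norm (1 - z * of_real a))\<^sup>2 = 1 - u"
    using z by (simp add: u_def)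
  then have "u < 1"
    using pos by (smt (verit) zero_less_power)
  have "Re (z\<^sup>2) = 2 * (Re z)\<^sup>2 - 1"
    using z by (simp add: power2_eq_square)
  then have eq: "u + u\<^sup>2 / 2 = 2 * log_euler_approx a z - 2 * (a ^ 3 * Re z) + a ^ 4 / 2"
    unfolding log_euler_approx_def \<open>Re (z\<^sup>2) = _\<close> u_def
    by (simp add: power2_eq_square power3_eq_cube power4_eq_xxxx field_simps)
  have Re_le: "\<bar>Re z\<bar> \<le> 1"
    using abs_Re_le_cmod[of z] assms(3) by simp
  then have "\<bar>a * Re z\<bar> \<le> a" "a ^ 3 * Re z \<le> a ^ 3"
    using assms(1) by (auto simp: abs_mult intro!: mult_left_le)
  moreover have "a\<^sup>2 \<le> a"
    using assms by (simp add: power2_eq_square mult_left_le)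
  ultimately have "\<bar>u\<bar> \<le> 3 * a"
    unfolding u_def using zero_le_power2[of a] by linarith
  then have "\<bar>u\<bar> ^ 3 \<le> (3 * a) ^ 3"
    by (rule power_mono) simp
  then have "- (27 * a ^ 3) \<le> u ^ 3"
    by (simp add: power_abs[symmetric] power_mult_distrib abs_le_iff)
  moreover have "0 \<le> a ^ 4" "0 \<le> a ^ 3"
    using assms(1) by auto
  ultimately have "2 * (log_euler_approx a z - 6 * a ^ 3) \<le> u + u\<^sup>2 / 2 + u ^ 3 / 3"
    using \<open>a ^ 3 * Re z \<le> a ^ 3\<close> unfolding eq by argo
  also have "\<dots> \<le> - ln (1 - u)"
    by (rule ln_one_minus_le_cubic) fact
  also have "ln (1 - u) = 2 * ln (norm (1 - z * of_real a))"
    using pos unfolding sq[symmetric] by (simp add: ln_realpow)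
  finally show ?thesis
    by simp
qed

definition primes_le :: "nat \<Rightarrow> nat set" where
  "primes_le y = {p. prime p \<and> p \<le> y}"

lemma finite_primes_le [simp, intro]: "finite (primes_le y)"
  unfolding primes_le_def by (rule finite_subset[of _ "{..y}"]) auto

lemma primes_le_mono: "z \<le> y \<Longrightarrow> primes_le z \<subseteq> primes_le y"
  unfolding primes_le_def by (rule Collect_mono) (blast intro: order_trans)

lemma card_primes_le_le: "card (primes_le y) \<le> y"
proof -
  have "card (primes_le y) \<le> card {1..y}"
    by (rule card_mono) (auto simp: primes_le_def Suc_le_eq prime_gt_0_nat)
  then show ?thesis by simp
qed

lemma smooth_numbers_primes_le: "1 \<le> n \<Longrightarrow> n \<le> y \<Longrightarrow> n \<in> smooth_numbers (primes_le y)"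
  unfolding smooth_numbers_def primes_le_def
  by (auto simp: in_prime_factors_iff dest!: dvd_imp_le)

text \<open>Above \<open>z\<close> the cubic errors are summable because
  \<open>s \<ge> 1 / 2\<close>. Up to \<open>z\<close> each factor has denominator at most 2 in
  norm, so it lowers the logarithm by at most 1 whatever the values of \<open>g\<close>; this frees
  the main term from the small primes.\<close>

lemma log_euler_product_ge:
  assumes g: "\<And>p. prime p \<Longrightarrow> norm (g p) = 1" and "z \<le> y" "s \<ge> 1 / 2"
  shows "(\<Sum>p\<in>primes_le y - primes_le z. log_euler_approx (real p powr - s) (g p))
      - 6 * (\<Sum>n. real n powr (- 3 / 2)) - real z
    \<le> ln (norm (\<Prod>p\<in>primes_le y. 1 / (1 - g p * of_real (real p powr - s))))"
proof -
  define A where "A p = - ln (norm (1 - g p * of_real (real p powr - s)))" for p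
  let ?B = "primes_le y - primes_le z"
  have a: "0 \<le> real p powr - s" "real p powr - s < 1" "(real p powr - s) ^ 3 \<le> real p powr (- 3 / 2)"
    if "prime p" for p
  proof -
    have p: "real p > 1"
      using prime_gt_1_nat[OF that] by simp
    then show "0 \<le> real p powr - s" "real p powr - s < 1"
      using assms(3) powr_less_one[of "real p" "- s"] by auto
    have "(real p powr - s) ^ 3 = real p powr (3 * - s)"
      using p by (simp add: powr_power)
    also have "\<dots> \<le> real p powr (- 3 / 2)"
      using p assms(3) by (intro powr_mono) auto
    finally show "(real p powr - s) ^ 3 \<le> real p powr (- 3 / 2)" .
  qed
  have norm_lt: "norm (g p * of_real (real p powr - s)) < 1" if "prime p" for p
    using g[OF that] a[OF that] by (simp add: norm_mult)
  have "(\<Sum>p\<in>?B. (real p powr - s) ^ 3) \<le> (\<Sum>p\<in>?B. real p powr (- 3 / 2))"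
    by (intro sum_mono a) (auto simp: primes_le_def)
  also have "\<dots> \<le> (\<Sum>n. real n powr (- 3 / 2))"
    by (intro sum_le_suminf) (auto simp: summable_real_powr_iff)
  finally have cube: "(\<Sum>p\<in>?B. (real p powr - s) ^ 3) \<le> (\<Sum>n. real n powr (- 3 / 2))" .
  have "(\<Sum>p\<in>?B. log_euler_approx (real p powr - s) (g p) - 6 * (real p powr - s) ^ 3) \<le> sum A ?B"
    unfolding A_def by (intro sum_mono log_euler_factor_ge a g) (auto simp: primes_le_def)
  then have B: "(\<Sum>p\<in>?B. log_euler_approx (real p powr - s) (g p)) - 6 * (\<Sum>n. real n powr (- 3 / 2)) \<le> sum A ?B"
    using cube by (simp add: sum_subtractf sum_distrib_left[symmetric])
  have "- 1 \<le> A p" if "p \<in> primes_le z" for p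
  proof -
    have p: "prime p"
      using that by (simp add: primes_le_def)
    have "norm (1 - g p * of_real (real p powr - s)) \<le> 2"
      using norm_triangle_ineq4[of 1 "g p * of_real (real p powr - s)"] norm_lt[OF p] by simp
    moreover have "0 < norm (1 - g p * of_real (real p powr - s))"
      using norm_lt[OF p] by auto
    ultimately have "ln (norm (1 - g p * of_real (real p powr - s))) \<le> 2 - 1"
      using ln_le_minus_one[of "norm (1 - g p * of_real (real p powr - s))"] by linarith
    then show ?thesis by (simp add: A_def)
  qed
  then have "(\<Sum>p\<in>primes_le z. - 1) \<le> sum A (primes_le z)"
    by (rule sum_mono)
  then have C: "- real z \<le> sum A (primes_le z)"
    using card_primes_le_le[of z] by simp
  have pos: "norm (1 - g p * of_real (real p powr - s)) > 0" if "p \<in> primes_le y" for p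
    using norm_lt[of p] that by (auto simp: primes_le_def)
  have "ln (norm (\<Prod>p\<in>primes_le y. 1 / (1 - g p * of_real (real p powr - s)))) =
      ln (\<Prod>p\<in>primes_le y. inverse (norm (1 - g p * of_real (real p powr - s))))"
    by (simp add: prod_norm[symmetric] norm_divide inverse_eq_divide)
  also have "\<dots> = (\<Sum>p\<in>primes_le y. ln (inverse (norm (1 - g p * of_real (real p powr - s)))))"
  proof (rule ln_prod)
    fix p assume "p \<in> primes_le y"
    from pos[OF this] show "inverse (norm (1 - g p * of_real (real p powr - s))) \<noteq> 0"
      by simp
  qed simp
  also have "\<dots> = sum A (primes_le y)"
    unfolding A_def by (intro sum.cong refl ln_inverse)
  also have "\<dots> = sum A ?B + sum A (primes_le z)"
    by (rule sum.subset_diff[OF primes_le_mono[OF assms(2)] finite_primes_le])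
  finally show ?thesis
    using B C by linarith
qed

text \<open>Euler's argument: the harmonic sum up to \<open>2 ^ m\<close> is at most the product of
  \<open>1 / (1 - 1 / p)\<close> over \<open>p \<le> 2 ^ m\<close>, which is at most the exponential
  of twice the sum of the reciprocals.\<close>

lemma sum_inverse_primes_ge:
  assumes "m > 0"
  shows "ln (real m / 2) / 2 \<le> (\<Sum>p\<in>primes_le (2 ^ m). 1 / real p)"
proof -
  define P where "P = primes_le (2 ^ m)"
  define h where "h p = (1 :: complex) * of_real (real p powr - 1)" for p
  have P: "finite P" "\<And>p. p \<in> P \<Longrightarrow> prime p"
    by (auto simp: P_def primes_le_def)
  have norm_h: "norm (h p) = 1 / real p" for p
    by (cases "p = 0") (simp_all add: h_def powr_minus_divide norm_divide)
  have p2: "1 / real p \<le> 1 / 2" if "p \<in> P" for p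
    using P(2)[OF that] prime_ge_2_nat[of p] by (auto simp: field_simps)
  define c where "c n = (if n \<in> smooth_numbers P then mult_ext h n else 0)" for n
  have c_eq: "c n = (if n \<in> smooth_numbers P then of_real (1 / real n) else 0)" for n
  proof (cases "n \<in> smooth_numbers P")
    case True
    then have "n > 0"
      by (simp add: smooth_numbers_def)
    then have "mult_ext h n = mult_ext (\<lambda>_. 1) n * of_real (real n powr - 1)"
      unfolding h_def by (rule mult_ext_powr)
    then show ?thesis
      using True \<open>n > 0\<close> by (simp add: c_def mult_ext_def powr_minus_divide)
  qed (simp add: c_def)
  have sums: "c sums (\<Prod>p\<in>P. 1 / (1 - h p))"
    unfolding c_def[abs_def] using p2 by (intro euler_product_finite P) (fastforce simp: norm_h)+
  have summ: "summable (\<lambda>n. norm (c n))"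
    unfolding c_def[abs_def] using p2 by (intro euler_product_finite P) (fastforce simp: norm_h)+
  have "real m / 2 \<le> ln (real (2 ^ m) + 1)"
  proof -
    have "real m / 2 \<le> real m * ln 2"
      using ln2_ge_two_thirds assms by simp
    also have "\<dots> = ln (2 ^ m)"
      by (simp add: ln_realpow)
    also have "\<dots> \<le> ln (real (2 ^ m) + 1)"
      by (subst ln_le_cancel_iff) (auto intro: add_pos_pos)
    finally show ?thesis .
  qed
  also have "\<dots> \<le> harm (2 ^ m)"
    by (rule ln_le_harm)
  also have "\<dots> = (\<Sum>n=1..2 ^ m. norm (c n))"
    unfolding harm_def
    by (intro sum.cong) (auto simp: c_eq P_def smooth_numbers_primes_le norm_divide field_simps)
  also have "\<dots> \<le> (\<Sum>n. norm (c n))"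
    by (intro sum_le_suminf summ) auto
  also have "\<dots> = (\<Prod>p\<in>P. 1 / (1 - 1 / real p))"
  proof -
    \<comment> \<open>The coefficients are nonnegative reals, so the complex Euler product also
      evaluates the series of norms.\<close>
    have "c = (\<lambda>n. of_real (norm (c n)))"
      by (auto simp: c_eq fun_eq_iff norm_divide)
    moreover have "(\<Prod>p\<in>P. 1 / (1 - h p)) = of_real (\<Prod>p\<in>P. 1 / (1 - 1 / real p))"
      unfolding of_real_prod by (intro prod.cong refl) (simp add: h_def powr_minus_divide)
    ultimately have "(\<lambda>n. complex_of_real (norm (c n))) sums of_real (\<Prod>p\<in>P. 1 / (1 - 1 / real p))"
      using sums by metis
    then have "(\<lambda>n. norm (c n)) sums (\<Prod>p\<in>P. 1 / (1 - 1 / real p))"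
      by (simp only: sums_of_real_iff)
    then show ?thesis
      by (rule sums_unique[symmetric])
  qed
  also have "\<dots> \<le> (\<Prod>p\<in>P. exp (2 * (1 / real p)))"
  proof (intro prod_mono conjI)
    fix p assume p: "p \<in> P"
    define x where "x = 1 / real p"
    have x: "0 \<le> x" "x \<le> 1 / 2"
      using p2[OF p] by (auto simp: x_def)
    then have "- (2 * x) \<le> - x - 2 * x\<^sup>2"
      using mult_left_mono[of x "1/2" x] by (simp add: power2_eq_square)
    also have "\<dots> \<le> ln (1 - x)"
      using x by (rule ln_one_minus_pos_lower_bound)
    finally have "exp (- (2 * x)) \<le> exp (ln (1 - x))"
      by simp
    then have "exp (- (2 * x)) \<le> 1 - x"
      using x by simp
    then show "1 / (1 - 1 / real p) \<le> exp (2 * (1 / real p))"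
      using x by (simp add: x_def[symmetric] exp_minus field_simps)
    show "0 \<le> 1 / (1 - 1 / real p)"
      using x by (simp add: x_def[symmetric])
  qed
  also have "\<dots> = exp (2 * (\<Sum>p\<in>P. 1 / real p))"
    by (simp add: exp_sum P(1) sum_distrib_left)
  finally have "ln (real m / 2) \<le> ln (exp (2 * (\<Sum>p\<in>P. 1 / real p)))"
    using assms by (subst ln_le_cancel_iff) auto
  then show ?thesis
    by (simp add: P_def)
qed

section \<open>Abel summation and its random remainder\<close>

definition smooth_sum :: "nat \<Rightarrow> (nat \<Rightarrow> complex) \<Rightarrow> nat \<Rightarrow> complex" where
  "smooth_sum y g n =
    (\<Sum>j\<in>{1..n} \<inter> smooth_numbers (primes_le y). mult_ext g j * of_real (1 / sqrt (real j)))"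

text \<open>
  What Abel summation of the sum of \<open>mult_ext g n / n powr (1/2 + \<sigma>)\<close> over the \<open>y\<close>-smooth \<open>n \<le> N\<close>
  leaves once the contribution of \<open>smooth_sum y g n\<close> with \<open>n \<le> y\<close> is split off.
\<close>
definition abel_remainder :: "real \<Rightarrow> nat \<Rightarrow> nat \<Rightarrow> (nat \<Rightarrow> complex) \<Rightarrow> real" where
  "abel_remainder \<sigma> y N g =
    (\<Sum>n\<in>{Suc y..N}. norm (smooth_sum y g n) * (real n powr - \<sigma> - real (Suc n) powr - \<sigma>))
      + norm (smooth_sum y g N) * real (Suc N) powr - \<sigma>"

lemma harm_le_ln:
  assumes "n \<ge> 1"
  shows "harm n \<le> 1 + ln (real n)"
  using assms
proof (induction rule: nat_induct_at_least)
  case (Suc n)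
  have "ln (real n) - ln (real (Suc n)) \<le> (real n - real (Suc n)) / real (Suc n)"
    using Suc.hyps by (intro ln_diff_le) auto
  also have "\<dots> = - inverse (real (Suc n))"
    by (simp add: field_simps)
  finally show ?case
    using Suc.IH by (simp add: harm_Suc)
qed (simp add: harm_def)

text \<open>Every positive integer up to \<open>y\<close> is \<open>y\<close>-smooth. This is the
  link between the Euler product and the sums in the theorem.\<close>

lemma smooth_sum_eq_weighted_sum:
  assumes "n \<le> y"
  shows "smooth_sum y g n = weighted_sum g (real n)"
proof -
  have "{1..n} \<inter> smooth_numbers (primes_le y) = {1..n}"
    using assms smooth_numbers_primes_le by auto
  then show ?thesis
    by (simp add: smooth_sum_def weighted_sum_def divide_inverse)
qed

text \<open>The cutoff \<open>N\<close> is fixed before \<open>g\<close>, so for random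
  \<open>g\<close> the remainder is one random variable with a computable expectation. The three
  terms on the right come from the tail beyond \<open>N\<close>, from \<open>n \<le> y\<close>, and
  from the rest of the Abel summation.\<close>

lemma norm_euler_product_le:
  assumes "\<sigma> > 0"
  shows "\<exists>N\<ge>y. \<forall>g B. (\<forall>p. prime p \<longrightarrow> norm (g p) = 1) \<longrightarrow>
    (\<forall>n\<in>{1..y}. norm (weighted_sum g (real n)) \<le> B) \<longrightarrow> 0 \<le> B \<longrightarrow>
    norm (\<Prod>p\<in>primes_le y. 1 / (1 - g p * of_real (real p powr - (1 / 2 + \<sigma>))))
      \<le> 1 + B + abel_remainder \<sigma> y N g"
proof -
  define P where "P = primes_le y"
  have P: "finite P" "\<And>p. p \<in> P \<Longrightarrow> prime p"
    by (auto simp: P_def primes_le_def)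
  \<comment> \<open>The common absolute value of the \<open>n\<close>-th term for all unimodular
    \<open>g\<close>; it makes the choice of \<open>N\<close> uniform in \<open>g\<close>.\<close>
  define b where "b n = (if n \<in> smooth_numbers P then real n powr - (1 / 2 + \<sigma>) else 0)" for n
  define h where "h g p = g p * of_real (real p powr - (1 / 2 + \<sigma>))" for g :: "nat \<Rightarrow> complex" and p
  define c where "c g n = (if n \<in> smooth_numbers P then mult_ext (h g) n else 0)" for g n
  have h: "norm (h g p) < 1" if "\<forall>p. prime p \<longrightarrow> norm (g p) = 1" "p \<in> P" for g p
    using that(1) P(2)[OF that(2)] assms prime_gt_1_nat[OF P(2)[OF that(2)]] powr_less_one[of "real p" "- (1 / 2 + \<sigma>)"]
    by (simp add: h_def norm_mult)
  have c_eq: "c g n = (if n \<in> smooth_numbers P then mult_ext g n * of_real (real n powr - (1 / 2 + \<sigma>)) else 0)" for g n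
    unfolding c_def h_def using mult_ext_powr[of n g] by (auto simp: smooth_numbers_def)
  have norm_c: "norm (c g n) = b n" if "\<forall>p. prime p \<longrightarrow> norm (g p) = 1" for g n
    using norm_mult_ext[of g n] that by (simp add: c_eq b_def norm_mult)
  have "summable (\<lambda>n. norm (c (\<lambda>_. 1) n))"
    unfolding c_def using h[of "\<lambda>_. 1"] by (intro euler_product_finite P) auto
  then have "summable b"
    using norm_c[of "\<lambda>_. 1"] by simp
  then obtain N0 where N0: "\<And>n. n \<ge> N0 \<Longrightarrow> norm (\<Sum>i. b (i + n)) < 1"
    using suminf_exist_split[of 1 b] by auto
  define N where "N = max N0 y"
  have "N0 \<le> Suc N" "y \<le> N"
    by (simp_all add: N_def)
  from N0[OF this(1)] have "(\<Sum>i. b (i + Suc N)) \<le> 1"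
    by (simp del: add_Suc_right)
  show ?thesis
  proof (intro exI[of _ N] conjI allI impI)
    show "y \<le> N" by fact
    fix g :: "nat \<Rightarrow> complex" and B :: real
    assume g: "\<forall>p. prime p \<longrightarrow> norm (g p) = 1"
      and B: "\<forall>n\<in>{1..y}. norm (weighted_sum g (real n)) \<le> B" "0 \<le> B"
    define w where "w n = real n powr - \<sigma>" for n :: nat
    define e where "e j = (if j \<in> smooth_numbers P then mult_ext g j * of_real (1 / sqrt (real j)) else 0)" for j
    have w_mono: "w (Suc n) \<le> w n" if "n \<ge> 1" for n
      using that assms by (simp add: w_def powr_mono2')
    have w1: "w 1 = 1" and w_nonneg: "w n \<ge> 0" for n
      by (simp_all add: w_def)
    have S: "(\<Sum>j=1..n. e j) = smooth_sum y g n" for n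
      unfolding e_def smooth_sum_def P_def by (simp add: sum.inter_restrict[symmetric])
    have c0: "c g 0 = 0"
      by (simp add: c_eq smooth_numbers_def)
    have sums: "c g sums (\<Prod>p\<in>P. 1 / (1 - h g p))"
      unfolding c_def[abs_def] using h[OF g] by (intro euler_product_finite P) auto
    have "norm (suminf (c g) - (\<Sum>n<Suc N. c g n)) = norm (\<Sum>i. c g (i + Suc N))"
      using sums suminf_minus_initial_segment[of "c g" "Suc N"] by (simp add: sums_iff)
    also have "\<dots> \<le> (\<Sum>i. norm (c g (i + Suc N)))"
      using \<open>summable b\<close> norm_c[OF g] by (intro summable_norm summable_ignore_initial_segment) simp
    also have "\<dots> \<le> 1"
      using norm_c[OF g] \<open>(\<Sum>i. b (i + Suc N)) \<le> 1\<close> by simp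
    finally have tail: "norm (\<Prod>p\<in>P. 1 / (1 - h g p)) \<le> 1 + norm (\<Sum>n<Suc N. c g n)"
      using sums_unique[OF sums] norm_triangle_ineq2[of "suminf (c g)" "\<Sum>n<Suc N. c g n"] by simp
    have "(\<Sum>n<Suc N. c g n) = (\<Sum>n=1..N. c g n)"
      using c0 by (intro sum.mono_neutral_cong_right) (auto simp: not_less_eq_eq)
    also have "\<dots> = (\<Sum>n=1..N. e n * of_real (w n))"
    proof (intro sum.cong refl)
      fix n assume "n \<in> {1..N}"
      then have "real n powr - (1 / 2 + \<sigma>) = 1 / sqrt (real n) * w n"
        by (simp add: w_def powr_add[symmetric] powr_half_sqrt[symmetric] powr_minus_divide[symmetric] powr_diff)
      then show "c g n = e n * of_real (w n)"
        by (simp add: c_eq e_def)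
    qed
    also have "\<dots> = (\<Sum>n=1..N. smooth_sum y g n * of_real (w n - w (Suc n))) + smooth_sum y g N * of_real (w (Suc N))"
      by (subst partial_summation) (simp only: S)
    finally have "norm (\<Sum>n<Suc N. c g n) \<le> norm (\<Sum>n=1..N. smooth_sum y g n * of_real (w n - w (Suc n)))
        + norm (smooth_sum y g N * of_real (w (Suc N)))"
      using norm_triangle_ineq by metis
    also have "norm (\<Sum>n=1..N. smooth_sum y g n * of_real (w n - w (Suc n)))
        \<le> (\<Sum>n=1..N. norm (smooth_sum y g n) * (w n - w (Suc n)))"
      using w_mono by (intro sum_norm_le) (auto simp: norm_mult simp flip: of_real_diff)
    also have "(\<Sum>n=1..N. norm (smooth_sum y g n) * (w n - w (Suc n))) =
        (\<Sum>n=1..y. norm (smooth_sum y g n) * (w n - w (Suc n))) +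
        (\<Sum>n=Suc y..N. norm (smooth_sum y g n) * (w n - w (Suc n)))"
    proof (subst sum.union_disjoint[symmetric])
      have "{1..N} = {1..y} \<union> {Suc y..N}"
        using \<open>y \<le> N\<close> by auto
      then show "(\<Sum>n=1..N. norm (smooth_sum y g n) * (w n - w (Suc n))) =
          (\<Sum>n\<in>{1..y} \<union> {Suc y..N}. norm (smooth_sum y g n) * (w n - w (Suc n)))"
        by (simp only:)
    qed auto
    \<comment> \<open>The weights decrease, so the bound \<open>B\<close> can be inserted termwise,
      after which the differences telescope.\<close>
    also have "(\<Sum>n=1..y. norm (smooth_sum y g n) * (w n - w (Suc n))) \<le> (\<Sum>n=1..y. B * (w n - w (Suc n)))"
      using B(1) w_mono by (intro sum_mono mult_right_mono) (auto simp: smooth_sum_eq_weighted_sum)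
    also have "(\<Sum>n=1..y. B * (w n - w (Suc n))) = B * (w 1 - w (Suc y))"
      by (induction y) (auto simp: algebra_simps)
    also have "\<dots> \<le> B"
      using B(2) w1 w_nonneg[of "Suc y"] by (simp add: mult_left_le)
    finally have "norm (\<Sum>n<Suc N. c g n) \<le> B + abel_remainder \<sigma> y N g"
      using w_nonneg[of "Suc N"] by (simp add: abel_remainder_def w_def norm_mult)
    with tail show "norm (\<Prod>p\<in>primes_le y. 1 / (1 - g p * of_real (real p powr - (1 / 2 + \<sigma>))))
        \<le> 1 + B + abel_remainder \<sigma> y N g"
      by (simp add: P_def h_def)
  qed
qed

context prob_space
begin

text \<open>The pointwise bound \<open>x \<le> 1 / 2 + x\<^sup>2 / 2\<close> reduces the claim to
  the second moment, which is at most a harmonic number. Logarithmic growth is harmless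
  here.\<close>

lemma expectation_norm_smooth_sum_le:
  assumes "steinhaus M f"
  shows "expectation (\<lambda>\<omega>. norm (smooth_sum y (\<lambda>p. f p \<omega>) n)) \<le> 1 + ln (real n)" (is ?le)
    and "integrable M (\<lambda>\<omega>. norm (smooth_sum y (\<lambda>p. f p \<omega>) n))" (is ?int)
proof -
  let ?J = "{1..n} \<inter> smooth_numbers (primes_le y)"
  let ?S = "\<lambda>\<omega>. smooth_sum y (\<lambda>p. f p \<omega>) n"
  have meas: "?S \<in> borel_measurable M"
    unfolding smooth_sum_def
    by (intro borel_measurable_sum borel_measurable_times measurable_mult_ext[OF assms]) auto
  have J: "j > 0" if "j \<in> ?J" for j
    using that by auto
  have int2: "integrable M (\<lambda>\<omega>. (norm (?S \<omega>))\<^sup>2)"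
    and E2: "expectation (\<lambda>\<omega>. (norm (?S \<omega>))\<^sup>2) = (\<Sum>j\<in>?J. (1 / sqrt (real j))\<^sup>2)"
    unfolding smooth_sum_def
    using steinhaus_second_moment[OF assms, where J = ?J and c = "\<lambda>j. 1 / sqrt (real j)"] J by auto
  have le: "norm (?S \<omega>) \<le> 1 / 2 + (norm (?S \<omega>))\<^sup>2 / 2" for \<omega>
    using zero_le_power2[of "norm (?S \<omega>) - 1"] by (simp add: power2_eq_square field_simps)
  have int_bd: "integrable M (\<lambda>\<omega>. 1 / 2 + (norm (?S \<omega>))\<^sup>2 / 2)"
    using int2 by simp
  show ?int
    by (rule Bochner_Integration.integrable_bound[OF int_bd])
       (use meas le in \<open>auto intro: order_trans[OF _ abs_ge_self]\<close>)
  then have "expectation (\<lambda>\<omega>. norm (?S \<omega>)) \<le> expectation (\<lambda>\<omega>. 1 / 2 + (norm (?S \<omega>))\<^sup>2 / 2)"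
    using int_bd le by (intro integral_mono) auto
  also have "\<dots> = 1 / 2 + (\<Sum>j\<in>?J. (1 / sqrt (real j))\<^sup>2) / 2"
    using int2 by (simp add: E2 prob_space)
  also have "(\<Sum>j\<in>?J. (1 / sqrt (real j))\<^sup>2) \<le> (\<Sum>j=1..n. (1 / sqrt (real j))\<^sup>2)"
    by (intro sum_mono2) auto
  also have "\<dots> = harm n"
    by (auto simp: harm_def power_divide inverse_eq_divide intro!: sum.cong)
  also have "(1 / 2 + harm n / 2 :: real) \<le> 1 + ln (real n)"
  \<comment> \<open>At \<open>n = 0\<close> the claim reads \<open>1 / 2 \<le> 1\<close>, by the
    convention \<open>ln 0 = 0\<close>.\<close>
  proof (cases "n = 0")
    case False
    then have "harm n \<le> 1 + ln (real n)"
      by (intro harm_le_ln) auto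
    moreover have "0 \<le> ln (real n)"
      using False by simp
    ultimately show ?thesis by simp
  qed (simp add: harm_def)
  finally show ?le by simp
qed

text \<open>Half of the decay \<open>n powr - \<sigma>\<close> absorbs the logarithm, at the price
  of a factor \<open>3 / \<sigma>\<close>. The other half, \<open>u n\<close>, still telescopes:
  \<open>u n * u n - u (Suc n) * u (Suc n)\<close> is at most \<open>2 * u n\<close> times
  \<open>u n - u (Suc n)\<close>.\<close>

lemma expectation_abel_remainder_le:
  assumes st: "steinhaus M f" and "0 < \<sigma>" "\<sigma> \<le> 1" "0 < y" "y \<le> N"
  shows "expectation (\<lambda>\<omega>. abel_remainder \<sigma> y N (\<lambda>p. f p \<omega>)) \<le> 6 / \<sigma> * real y powr - (\<sigma> / 2)"
    and "integrable M (\<lambda>\<omega>. abel_remainder \<sigma> y N (\<lambda>p. f p \<omega>))"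
proof -
  note int = expectation_norm_smooth_sum_le(2)[OF st]
  show "integrable M (\<lambda>\<omega>. abel_remainder \<sigma> y N (\<lambda>p. f p \<omega>))"
    unfolding abel_remainder_def
    by (intro Bochner_Integration.integrable_add Bochner_Integration.integrable_sum integrable_mult_left int)
  define u where "u n = real n powr - (\<sigma> / 2)" for n
  have u2: "real n powr - \<sigma> = u n * u n" for n
    by (simp add: u_def powr_add[symmetric])
  have u_pos: "u n > 0" if "n > 0" for n
    using that by (simp add: u_def)
  have u_mono: "u (Suc n) \<le> u n" if "n > 0" for n
    using that assms(2) by (simp add: u_def powr_mono2')
  have E: "expectation (\<lambda>\<omega>. norm (smooth_sum y (\<lambda>p. f p \<omega>) n)) \<le> 3 / \<sigma> * (1 / u n)" if "n > 0" for n
  proof -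
    have "ln (real n) \<le> real n powr (\<sigma> / 2) / (\<sigma> / 2)"
      using that assms(2) by (intro ln_powr_bound) auto
    moreover have "1 \<le> 1 / \<sigma> * real n powr (\<sigma> / 2)"
      using that assms(2,3) mult_mono[of 1 "1 / \<sigma>" 1 "real n powr (\<sigma> / 2)"] ge_one_powr_ge_zero[of "real n" "\<sigma> / 2"]
      by simp
    ultimately have "1 + ln (real n) \<le> 3 / \<sigma> * real n powr (\<sigma> / 2)"
      by (simp add: field_simps)
    also have "real n powr (\<sigma> / 2) = 1 / u n"
      by (simp add: u_def powr_minus_divide)
    finally show ?thesis
      using expectation_norm_smooth_sum_le(1)[OF st, of y n] by linarith
  qed
  have "expectation (\<lambda>\<omega>. abel_remainder \<sigma> y N (\<lambda>p. f p \<omega>)) =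
      (\<Sum>n=Suc y..N. expectation (\<lambda>\<omega>. norm (smooth_sum y (\<lambda>p. f p \<omega>) n)) * (u n * u n - u (Suc n) * u (Suc n)))
      + expectation (\<lambda>\<omega>. norm (smooth_sum y (\<lambda>p. f p \<omega>) N)) * (u (Suc N) * u (Suc N))"
    unfolding abel_remainder_def u2
    by (subst Bochner_Integration.integral_add,
        (intro Bochner_Integration.integrable_sum integrable_mult_left int)+,
        subst Bochner_Integration.integral_sum, intro integrable_mult_left int, simp)
  also have "\<dots> \<le> (\<Sum>n=Suc y..N. 6 / \<sigma> * (u n - u (Suc n))) + 6 / \<sigma> * u (Suc N)"
  proof (intro add_mono sum_mono)
    fix n assume "n \<in> {Suc y..N}"
    then have n: "n > 0" by simp
    note u = u_pos[OF n] u_pos[of "Suc n"] u_mono[OF n]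
    have "0 \<le> (u n - u (Suc n)) * (u n + u (Suc n))"
      using u by simp
    then have "expectation (\<lambda>\<omega>. norm (smooth_sum y (\<lambda>p. f p \<omega>) n)) * (u n * u n - u (Suc n) * u (Suc n))
        \<le> 3 / \<sigma> * (1 / u n) * (u n * u n - u (Suc n) * u (Suc n))"
      using E[OF n] by (intro mult_right_mono) (auto simp: algebra_simps)
    also have "\<dots> = 3 / \<sigma> * (u n - u (Suc n)) * ((u n + u (Suc n)) / u n)"
      by (simp add: field_simps)
    also have "\<dots> \<le> 3 / \<sigma> * (u n - u (Suc n)) * 2"
      using u assms(2) by (intro mult_left_mono) (auto simp: divide_le_eq)
    finally show "expectation (\<lambda>\<omega>. norm (smooth_sum y (\<lambda>p. f p \<omega>) n)) * (u n * u n - u (Suc n) * u (Suc n))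
        \<le> 6 / \<sigma> * (u n - u (Suc n))"
      by simp
  next
    have N: "N > 0"
      using assms by simp
    note u = u_pos[OF N] u_pos[of "Suc N"] u_mono[OF N]
    have "expectation (\<lambda>\<omega>. norm (smooth_sum y (\<lambda>p. f p \<omega>) N)) * (u (Suc N) * u (Suc N))
        \<le> 3 / \<sigma> * (1 / u N) * (u (Suc N) * u (Suc N))"
      using E[OF N] by (intro mult_right_mono) auto
    also have "\<dots> = 3 / \<sigma> * u (Suc N) * (u (Suc N) / u N)"
      by simp
    also have "\<dots> \<le> 3 / \<sigma> * u (Suc N) * 2"
      using u assms(2) by (intro mult_left_mono) (auto simp: divide_le_eq)
    finally show "expectation (\<lambda>\<omega>. norm (smooth_sum y (\<lambda>p. f p \<omega>) N)) * (u (Suc N) * u (Suc N)) \<le> 6 / \<sigma> * u (Suc N)"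
      by simp
  qed
  also have "(\<Sum>n=Suc y..N. 6 / \<sigma> * (u n - u (Suc n))) = 6 / \<sigma> * (u (Suc y) - u (Suc N))"
    unfolding sum_distrib_left[symmetric] sum_Suc_diff'
    using assms(5) by (induction rule: dec_induct) (auto simp: algebra_simps)
  also have "6 / \<sigma> * (u (Suc y) - u (Suc N)) + 6 / \<sigma> * u (Suc N) \<le> 6 / \<sigma> * u y"
    using u_mono[OF assms(4)] assms(2) by (simp add: algebra_simps divide_right_mono)
  finally show "expectation (\<lambda>\<omega>. abel_remainder \<sigma> y N (\<lambda>p. f p \<omega>)) \<le> 6 / \<sigma> * real y powr - (\<sigma> / 2)"
    by (simp add: u_def)
qed

end

section \<open>The limit superior\<close>

text \<open>The index \<open>n\<close> found at scale \<open>m\<close> may be much smaller than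
  \<open>2 ^ (m ^ 2)\<close>, but this only helps: the denominator increases and
  \<open>ln (ln n) \<le> 2 * ln m\<close>. The bound at scale \<open>m\<close> tends to infinity, so
  \<open>n\<close> cannot stay bounded.\<close>

lemma limsup_ge_one:
  fixes W :: "real \<Rightarrow> complex"
  assumes "L > 0"
    and large: "\<And>k. \<exists>m\<ge>k. \<exists>n\<in>{1..2 ^ (m ^ 2)}. exp (2 * L * sqrt (ln (real m))) < norm (W (real n))"
  shows "Limsup at_top (\<lambda>T. ereal (norm (W T) / exp (L * sqrt (ln (ln T))))) \<ge> 1"
proof (rule ccontr)
  assume "\<not> ?thesis"
  then have "Limsup at_top (\<lambda>T. ereal (norm (W T) / exp (L * sqrt (ln (ln T))))) < 1"
    by simp
  then have "\<forall>\<^sub>F T in at_top. ereal (norm (W T) / exp (L * sqrt (ln (ln T)))) < 1"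
    by (rule Limsup_lessD)
  then obtain T0 where T0: "\<And>T. T \<ge> T0 \<Longrightarrow> norm (W T) < exp (L * sqrt (ln (ln T)))"
    by (auto simp: eventually_at_top_linorder)
  define n0 where "n0 = max 3 (nat \<lceil>T0\<rceil>)"
  define D where "D = (\<Sum>n<n0. norm (W (real n)))"
  have D: "norm (W (real n)) \<le> D" if "n < n0" for n
    unfolding D_def using that by (intro member_le_sum) auto
  have "filterlim (\<lambda>m::nat. exp (2 * L * sqrt (ln (real m)))) at_top sequentially"
    using assms(1) by real_asymp
  then have "eventually (\<lambda>m. D \<le> exp (2 * L * sqrt (ln (real m)))) sequentially"
    by (simp add: filterlim_at_top)
  then obtain k where k: "\<And>m. m \<ge> k \<Longrightarrow> D \<le> exp (2 * L * sqrt (ln (real m)))"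
    by (auto simp: eventually_sequentially)
  obtain m n where mn: "m \<ge> max k 1" "n \<in> {1..2 ^ (m ^ 2)}"
    "exp (2 * L * sqrt (ln (real m))) < norm (W (real n))"
    using large[of "max k 1"] by blast
  then have "\<not> n < n0"
    using D[of n] k[of m] by fastforce
  then have n: "n \<ge> 3" "real n \<ge> T0"
    by (auto simp: n0_def) linarith
  have "ln 3 \<le> ln (real n)"
    using n by simp
  then have "ln (real n) > 0"
    using ln_gt_zero[of "3::real"] by linarith
  have "ln (real n) \<le> ln (real (2 ^ (m ^ 2)))"
    using mn(2) n(1) by (subst ln_le_cancel_iff) (auto simp del: of_nat_power)
  also have "\<dots> = real m ^ 2 * ln 2"
    by (simp add: ln_realpow)
  also have "\<dots> \<le> real m ^ 2"
    using ln_le_minus_one[of "2::real"] by (intro mult_left_le) auto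
  finally have "ln (ln (real n)) \<le> ln (real m ^ 2)"
    using \<open>ln (real n) > 0\<close> mn(1) by (subst ln_le_cancel_iff) auto
  also have "\<dots> = 2 * ln (real m)"
    using mn(1) by (simp add: ln_realpow)
  \<comment> \<open>Rounding 2 up to 4 gives the exact root 2, matching the constant
    \<open>2 * L\<close> in the hypothesis.\<close>
  also have "\<dots> \<le> 4 * ln (real m)"
    using mn(1) by simp
  finally have "sqrt (ln (ln (real n))) \<le> sqrt (4 * ln (real m))"
    by simp
  then have "sqrt (ln (ln (real n))) \<le> 2 * sqrt (ln (real m))"
    by (simp add: real_sqrt_mult)
  then have "exp (L * sqrt (ln (ln (real n)))) \<le> exp (2 * L * sqrt (ln (real m)))"
    using assms(1) by simp
  then show False
    using T0[OF n(2)] mn(3) by linarith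
qed

section \<open>Variance of a block and choice of the scale\<close>

text \<open>Primes up to \<open>2 ^ m\<close> suffice: for them
  \<open>p powr (2 / m) \<le> 4\<close>, so the shift by \<open>1 / m\<close> costs only a factor 4
  against \<open>1 / p\<close>. Removing the primes up to \<open>z\<close> loses at most
  \<open>z\<close>.\<close>

lemma variance_ge:
  assumes "m > 0"
  shows "(ln (real m / 2) / 2 - real z) / 4 \<le>
    (\<Sum>p\<in>primes_le (2 ^ (m ^ 2)) - primes_le z. (real p powr - (1 / 2 + 1 / real m))\<^sup>2)"
proof -
  have "(\<Sum>p\<in>primes_le z. 1 / real p) \<le> (\<Sum>p\<in>primes_le z. 1)"
    by (intro sum_mono) (auto simp: primes_le_def field_simps Suc_le_eq prime_gt_0_nat)
  also have "\<dots> \<le> real z"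
    using card_primes_le_le[of z] by simp
  finally have z: "(\<Sum>p\<in>primes_le z. 1 / real p) \<le> real z" .
  let ?A = "primes_le (2 ^ m)"
  have "(\<Sum>p\<in>?A. 1 / real p) = (\<Sum>p\<in>?A - primes_le z. 1 / real p) + (\<Sum>p\<in>?A \<inter> primes_le z. 1 / real p)"
    by (subst sum.Int_Diff[of _ _ "primes_le z"]) auto
  also have "(\<Sum>p\<in>?A \<inter> primes_le z. 1 / real p) \<le> (\<Sum>p\<in>primes_le z. 1 / real p)"
    by (intro sum_mono2) auto
  finally have "(ln (real m / 2) / 2 - real z) / 4 \<le> (\<Sum>p\<in>?A - primes_le z. 1 / real p) / 4"
    using z sum_inverse_primes_ge[OF assms] by simp
  also have "\<dots> = (\<Sum>p\<in>?A - primes_le z. 1 / real p / 4)"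
    by (rule sum_divide_distrib)
  also have "\<dots> \<le> (\<Sum>p\<in>?A - primes_le z. (real p powr - (1 / 2 + 1 / real m))\<^sup>2)"
  proof (intro sum_mono)
    fix p assume "p \<in> ?A - primes_le z"
    then have p: "p > 0" "real p \<le> 2 ^ m"
      by (auto simp: primes_le_def prime_gt_0_nat)
    have "real p powr (2 / real m) \<le> (2 ^ m) powr (2 / real m)"
      using p by (intro powr_mono2) auto
    also have "\<dots> = 4"
      using assms by (simp add: powr_realpow[symmetric] powr_powr)
    finally have "real p * real p powr (2 / real m) \<le> real p * 4"
      by (intro mult_left_mono) auto
    then have "1 / (real p * 4) \<le> 1 / (real p * real p powr (2 / real m))"
      using p by (intro frac_le) auto
    also have "\<dots> = real p powr (- 1) * real p powr (- (2 / real m))"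
      using p by (simp add: powr_minus_divide)
    also have "\<dots> = (real p powr - (1 / 2 + 1 / real m))\<^sup>2"
    proof -
      have "- 1 + - (2 / real m) = - (1 / 2 + 1 / real m) + - (1 / 2 + 1 / real m)"
        by simp
      then show ?thesis
        by (simp only: power2_eq_square powr_add[symmetric])
    qed
    finally show "1 / real p / 4 \<le> (real p powr - (1 / 2 + 1 / real m))\<^sup>2"
      by simp
  qed
  also have "\<dots> \<le> (\<Sum>p\<in>primes_le (2 ^ (m ^ 2)) - primes_le z. (real p powr - (1 / 2 + 1 / real m))\<^sup>2)"
  proof (intro sum_mono2 Diff_mono primes_le_mono)
    show "(2::nat) ^ m \<le> 2 ^ (m ^ 2)"
      using assms by (intro power_increasing) (auto simp: power2_eq_square)
  qed auto
  finally show ?thesis .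
qed

text \<open>For fixed \<open>z\<close>, \<open>c\<close> and \<open>k\<close> every requirement
  holds for all large \<open>m\<close>. The variance is at least \<open>ln m / 16\<close>, so
  \<open>K\<close> standard deviations amount to at least
  \<open>(2 * L + 1) * sqrt (ln m)\<close>.\<close>

lemma exists_scale:
  assumes "L > 0" and K: "K = 4 * (2 * L + 1)"
  shows "\<exists>m>0. k \<le> m \<and> z \<le> 2 ^ (m ^ 2) \<and>
    64 * (K + 1) \<le> sqrt (\<Sum>p\<in>primes_le (2 ^ (m ^ 2)) - primes_le z. (real p powr - (1 / 2 + 1 / real m))\<^sup>2) \<and>
    6 * real m * 2 powr (- real m / 2) \<le> (1 / 2) ^ k \<and>
    2 + exp (2 * L * sqrt (ln (real m))) \<le>
      exp (K * sqrt (\<Sum>p\<in>primes_le (2 ^ (m ^ 2)) - primes_le z. (real p powr - (1 / 2 + 1 / real m))\<^sup>2) - c - real z)"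
proof -
  have "eventually (\<lambda>m. m > 0 \<and> k \<le> m \<and> z \<le> m) sequentially"
    using eventually_ge_at_top[of "max k (max z 1)"] by eventually_elim auto
  moreover have "eventually (\<lambda>m. 6 * real m * 2 powr (- real m / 2) \<le> (1 / 2) ^ k) sequentially"
  proof (rule eventually_mono)
    have "(\<lambda>m::nat. 6 * real m * 2 powr (- real m / 2)) \<longlonglongrightarrow> 0"
      by real_asymp
    then show "\<forall>\<^sub>F m in sequentially. 6 * real m * 2 powr (- real m / 2) < (1 / 2) ^ k"
      by (rule order_tendstoD) simp
  qed simp
  moreover have "filterlim (\<lambda>m::nat. sqrt (ln (real m))) at_top sequentially"
    by real_asymp
  then have "eventually (\<lambda>m. max (4 * (64 * (K + 1))) (c + real z + 2) \<le> sqrt (ln (real m))) sequentially"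
    unfolding filterlim_at_top by blast
  moreover have "filterlim (\<lambda>m::nat. ln (real m)) at_top sequentially"
    by real_asymp
  \<comment> \<open>This threshold is exactly what makes the bound of \<open>variance_ge\<close> at
    least \<open>ln m / 16\<close>.\<close>
  then have "eventually (\<lambda>m. 2 * ln 2 + 4 * real z \<le> ln (real m)) sequentially"
    unfolding filterlim_at_top by blast
  ultimately have "eventually (\<lambda>m. (m > 0 \<and> k \<le> m \<and> z \<le> m) \<and> 6 * real m * 2 powr (- real m / 2) \<le> (1 / 2) ^ k \<and>
    max (4 * (64 * (K + 1))) (c + real z + 2) \<le> sqrt (ln (real m)) \<and> 2 * ln 2 + 4 * real z \<le> ln (real m)) sequentially"
    by eventually_elim blast
  then obtain m where m: "m > 0" "k \<le> m" "z \<le> m" "6 * real m * 2 powr (- real m / 2) \<le> (1 / 2) ^ k"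
    "4 * (64 * (K + 1)) \<le> sqrt (ln (real m))" "c + real z + 2 \<le> sqrt (ln (real m))"
    "2 * ln 2 + 4 * real z \<le> ln (real m)"
    unfolding eventually_sequentially by auto
  define V where "V = (\<Sum>p\<in>primes_le (2 ^ (m ^ 2)) - primes_le z. (real p powr - (1 / 2 + 1 / real m))\<^sup>2)"
  have "ln (real m) / 16 \<le> (ln (real m / 2) / 2 - real z) / 4"
    using m(1,7) by (simp add: ln_div field_simps)
  also have "\<dots> \<le> V"
    unfolding V_def by (rule variance_ge) fact
  finally have "sqrt (ln (real m) / 16) \<le> sqrt V"
    by (rule real_sqrt_le_mono)
  moreover have "sqrt (16 :: real) = 4"
    by (rule real_sqrt_unique) auto
  ultimately have V: "sqrt (ln (real m)) / 4 \<le> sqrt V"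
    by (simp add: real_sqrt_divide)
  have "m \<le> m ^ 2"
    using m(1) by (simp add: power2_eq_square)
  then have "z \<le> 2 ^ (m ^ 2)"
    using m(3) less_exp[of "m ^ 2"] by linarith
  moreover have "64 * (K + 1) \<le> sqrt V"
    using m(5) V by linarith
  moreover have "2 + exp (2 * L * sqrt (ln (real m))) \<le> exp (K * sqrt V - c - real z)"
  proof -
    define s where "s = sqrt (ln (real m))"
    have s: "s \<ge> 0"
      using m(1) by (simp add: s_def)
    have "K * (s / 4) \<le> K * sqrt V"
      using V assms by (intro mult_left_mono) (auto simp: s_def)
    \<comment> \<open>Since \<open>K / 4 = 2 * L + 1\<close>, one copy of \<open>s\<close> is left
      over to absorb \<open>c + z + 2\<close>. The summand 2 then pays for the additive 2 outside
      the exponential, because \<open>exp 2 \<ge> 3\<close>.\<close>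
    then have "2 * L * s + 2 \<le> K * sqrt V - c - real z"
      using m(6) by (simp add: K s_def[symmetric] algebra_simps)
    then have "exp 2 * exp (2 * L * s) \<le> exp (K * sqrt V - c - real z)"
      by (simp add: exp_add[symmetric] add.commute)
    moreover have "3 * exp (2 * L * s) \<le> exp 2 * exp (2 * L * s)"
      using exp_ge_add_one_self[of 2] by (intro mult_right_mono) auto
    moreover have "1 \<le> exp (2 * L * s)"
      using assms(1) s by simp
    ultimately show ?thesis
      unfolding s_def[symmetric] by linarith
  qed
  ultimately show ?thesis
    using m(1,2,4) unfolding V_def by blast
qed

section \<open>Independent blocks and Borel-Cantelli arguments\<close>

context prob_space
begin

text \<open>By the zero-one law the alternative is that almost surely only finitely many events
  occur. Then the probabilities of the tail unions would tend to 0, but each is at least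
  \<open>\<delta>\<close>.\<close>

lemma AE_infinite_of_indep_events:
  fixes G :: "nat \<Rightarrow> 'a \<Rightarrow> bool"
  assumes "indep_events (\<lambda>k. {\<omega>\<in>space M. G k \<omega>}) UNIV" "0 < \<delta>"
    and "\<And>k. \<delta> \<le> prob {\<omega>\<in>space M. G k \<omega>}"
  shows "AE \<omega> in M. infinite {k. G k \<omega>}"
proof (rule ccontr)
  assume "\<not> ?thesis"
  then have fin: "AE \<omega> in M. finite {k. G k \<omega>}"
    using borel_0_1_law_AE[OF assms(1)] by blast
  have [measurable]: "{\<omega>\<in>space M. G k \<omega>} \<in> events" for k
    using assms(1) by (auto simp: indep_events_def)
  define U where "U n = (\<Union>k\<in>{n..}. {\<omega>\<in>space M. G k \<omega>})" for n :: nat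
  have U [measurable]: "U n \<in> events" for n
    unfolding U_def by measurable
  have "decseq U"
    unfolding U_def by (intro antimonoI UN_mono) auto
  then have "(\<lambda>n. prob (U n)) \<longlonglongrightarrow> prob (\<Inter>n. U n)"
    using U by (intro finite_Lim_measure_decseq) auto
  moreover have "prob (\<Inter>n. U n) = 0"
  proof -
    have "AE \<omega> in M. \<omega> \<notin> (\<Inter>n. U n)"
      using fin
    proof eventually_elim
      case (elim \<omega>)
      then obtain n where "\<And>k. G k \<omega> \<Longrightarrow> k \<le> n"
        by (auto simp: finite_nat_set_iff_bounded_le)
      then have "\<omega> \<notin> U (Suc n)"
        by (force simp: U_def)
      then show ?case by blast
    qed
    then show ?thesis
      by (subst prob_eq_0) auto
  qed
  ultimately have "(\<lambda>n. prob (U n)) \<longlonglongrightarrow> 0"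
    by simp
  moreover have "\<delta> \<le> prob (U n)" for n
  proof -
    have "prob {\<omega>\<in>space M. G n \<omega>} \<le> prob (U n)"
      by (rule finite_measure_mono) (auto simp: U_def[symmetric], auto simp: U_def)
    then show ?thesis
      using assms(3)[of n] by linarith
  qed
  ultimately have "\<delta> \<le> 0"
    by (intro LIMSEQ_le_const) auto
  then show False
    using assms(2) by simp
qed

text \<open>Restrictions of an independent family to disjoint index sets are independent random
  vectors, and each sum is a measurable function of its own vector.\<close>

lemma steinhaus_indep_blocks:
  fixes u :: "nat \<Rightarrow> nat \<Rightarrow> complex \<Rightarrow> real"
  assumes "steinhaus M f" "disjoint_family B" "\<And>k p. p \<in> B k \<Longrightarrow> prime p"
    and [measurable]: "\<And>k p. u k p \<in> borel_measurable borel"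
  shows "indep_events (\<lambda>k. {\<omega>\<in>space M. c k \<le> (\<Sum>p\<in>B k. u k p (f p \<omega>))}) UNIV"
proof -
  have "indep_vars (\<lambda>_. borel) f {p. prime p}"
    using assms(1) unfolding steinhaus_def by blast
  then have "indep_vars (\<lambda>k. PiM (B k) (\<lambda>_. borel)) (\<lambda>k \<omega>. restrict (\<lambda>p. f p \<omega>) (B k)) UNIV"
    by (rule indep_vars_restrict) (use assms(2,3) in auto)
  then have "indep_vars (\<lambda>_. borel) (\<lambda>k \<omega>. \<Sum>p\<in>B k. u k p (restrict (\<lambda>p. f p \<omega>) (B k) p)) UNIV"
    by (rule indep_vars_compose2) measurable
  then have "indep_vars (\<lambda>_. borel) (\<lambda>k \<omega>. \<Sum>p\<in>B k. u k p (f p \<omega>)) UNIV"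
    by (simp cong: sum.cong)
  then show ?thesis
    by (rule indep_eventsI_indep_vars) measurable
qed

lemma AE_abel_remainder_less_1:
  assumes st: "steinhaus M f" and m: "\<And>k. m k > 0" "\<And>k. 6 * real (m k) * 2 powr (- real (m k) / 2) \<le> (1 / 2) ^ k"
    and N: "\<And>k. 2 ^ (m k ^ 2) \<le> N k"
  shows "AE \<omega> in M. eventually (\<lambda>k. abel_remainder (1 / real (m k)) (2 ^ (m k ^ 2)) (N k) (\<lambda>p. f p \<omega>) < 1) sequentially"
proof -
  define R where "R k \<omega> = abel_remainder (1 / real (m k)) (2 ^ (m k ^ 2)) (N k) (\<lambda>p. f p \<omega>)" for k \<omega>
  have m1: "0 < 1 / real (m k)" "1 / real (m k) \<le> 1" for k
    using m(1)[of k] by auto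
  have int: "integrable M (R k)" for k
    unfolding R_def by (rule expectation_abel_remainder_le(2)[OF st m1 _ N]) simp
  have ER: "expectation (R k) \<le> 6 / (1 / real (m k)) * real (2 ^ (m k ^ 2)) powr - (1 / real (m k) / 2)" for k
    unfolding R_def by (rule expectation_abel_remainder_le(1)[OF st m1 _ N]) simp
  have "expectation (R k) \<le> (1 / 2) ^ k" for k
  proof -
    have "expectation (R k) \<le> 6 * real (m k) * real (2 ^ (m k ^ 2)) powr - (1 / real (m k) / 2)"
      using ER[of k] by simp
    \<comment> \<open>The squared exponent in \<open>y = 2 ^ (m ^ 2)\<close> pays off here: with
      \<open>\<sigma> = 1 / m\<close>, the power \<open>y powr - (\<sigma> / 2)\<close> is still
      exponentially small in \<open>m\<close>.\<close>
    also have "real (2 ^ (m k ^ 2)) powr - (1 / real (m k) / 2) = 2 powr (- real (m k) / 2)"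
      using m(1)[of k] by (simp add: powr_realpow[symmetric] powr_powr power2_eq_square)
    also note m(2)[of k]
    finally show ?thesis .
  qed
  moreover have nonneg: "0 \<le> R k \<omega>" for k \<omega>
    unfolding R_def abel_remainder_def using m(1)[of k]
    by (intro add_nonneg_nonneg sum_nonneg mult_nonneg_nonneg) (auto intro!: powr_mono2')
  ultimately have bound: "prob {\<omega>\<in>space M. 1 \<le> R k \<omega>} \<le> (1 / 2) ^ k" for k
    using integral_Markov_inequality_measure[OF int[of k], of "{}" 1] by (force intro: order_trans)
  have meas: "R k \<in> borel_measurable M" for k
    using int[of k] by simp
  have "AE \<omega> in M. eventually (\<lambda>k. \<omega> \<in> space M - {\<omega>\<in>space M. 1 \<le> R k \<omega>}) sequentially"
  proof (rule borel_cantelli_AE1)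
    show "summable (\<lambda>k. prob {\<omega>\<in>space M. 1 \<le> R k \<omega>})"
      by (rule summable_comparison_test'[of "\<lambda>k. (1 / 2) ^ k" 0]) (use bound in \<open>auto intro: summable_geometric\<close>)
  qed (use meas in \<open>auto simp: emeasure_eq_measure\<close>)
  then show ?thesis
    unfolding R_def[symmetric] by eventually_elim (auto elim!: eventually_mono)
qed

end

theorem theorem4:
  fixes M :: "'a measure" and f :: "nat \<Rightarrow> 'a \<Rightarrow> complex" and L :: real
  assumes "prob_space M"
    and "steinhaus M f"
    and "L > 0"
  shows "\<exists>\<epsilon> :: real \<Rightarrow> real. (\<epsilon> \<longlongrightarrow> 0) at_top \<and>
    (AE \<omega> in M. Limsup at_top (\<lambda>T. ereal (cmod (weighted_sum (\<lambda>p. f p \<omega>) T) /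
        exp ((L + \<epsilon> T) * sqrt (ln (ln T))))) \<ge> 1)"
proof -
  interpret prob_space M by fact
  define K where "K = 4 * (2 * L + 1)"
  define c where "c = 6 * (\<Sum>n. real n powr (- 3 / 2))"
  define V where "V z m = (\<Sum>p\<in>primes_le (2 ^ (m ^ 2)) - primes_le z. (real p powr - (1 / 2 + 1 / real m))\<^sup>2)" for z m
  define good where "good k z m \<longleftrightarrow> m > 0 \<and> k \<le> m \<and> z \<le> 2 ^ (m ^ 2) \<and> 64 * (K + 1) \<le> sqrt (V z m) \<and>
    6 * real m * 2 powr (- real m / 2) \<le> (1 / 2) ^ k \<and>
    2 + exp (2 * L * sqrt (ln (real m))) \<le> exp (K * sqrt (V z m) - c - real z)" for k z m
  have ex: "\<exists>m. good k z m" for k z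
    using exists_scale[OF assms(3) K_def, of k z c] unfolding good_def V_def by blast
  \<comment> \<open>The scales are chosen recursively, each one large in terms of the last prime
    cutoff of its predecessor.\<close>
  obtain m' where m': "\<And>k. good k (2 ^ (m' k ^ 2)) (m' (Suc k))"
    using dependent_nat_choice[of "\<lambda>_ _. True" "\<lambda>k a b. good k (2 ^ (a ^ 2)) b"] ex by auto
  \<comment> \<open>After this shift block \<open>k\<close> runs from \<open>z k\<close>, the cutoff
    of the previous scale, to \<open>y k\<close>. As \<open>z (Suc k) = y k\<close>, the blocks are
    disjoint.\<close>
  define m where "m k = m' (Suc k)" for k
  define z where "z k = (2 :: nat) ^ (m' k ^ 2)" for k
  define y where "y k = (2 :: nat) ^ (m k ^ 2)" for k
  define B where "B k = primes_le (y k) - primes_le (z k)" for k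
  define a where "a k p = real p powr - (1 / 2 + 1 / real (m k))" for k p
  have good: "good k (z k) (m k)" for k
    using m' by (simp add: z_def m_def)
  then have m_pos: "m k > 0" and k_le: "k \<le> m k" and z_le: "z k \<le> y k"
    and V_ge: "64 * (K + 1) \<le> sqrt (V (z k) (m k))"
    and small: "6 * real (m k) * 2 powr (- real (m k) / 2) \<le> (1 / 2) ^ k"
    and large: "2 + exp (2 * L * sqrt (ln (real (m k)))) \<le> exp (K * sqrt (V (z k) (m k)) - c - real (z k))" for k
    unfolding good_def y_def by blast+
  have V_eq: "V (z k) (m k) = (\<Sum>p\<in>B k. (a k p)\<^sup>2)" for k
    by (simp add: V_def B_def a_def y_def)
  have "z (Suc k) = y k" for k
    by (simp add: z_def y_def m_def)
  then have "incseq z"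
    using z_le by (auto intro!: incseq_SucI)
  then have "y j \<le> z k" if "j < k" for j k
    using that \<open>\<And>k. z (Suc k) = y k\<close> incseqD[of z "Suc j" k] by (auto simp: Suc_le_eq)
  then have "B j \<inter> B k = {}" if "j < k" for j k
    using primes_le_mono[of "y j" "z k"] that by (auto simp: B_def)
  then have disj: "disjoint_family B"
    unfolding disjoint_family_on_def by (metis Int_commute linorder_neqE_nat)
  have B: "finite (B k)" "\<And>p. p \<in> B k \<Longrightarrow> prime p" for k
    by (auto simp: B_def primes_le_def[of "y k"])
  have a: "0 \<le> a k p \<and> a k p \<le> 1" if "p \<in> B k" for k p
  proof -
    have "1 \<le> real p"
      using prime_ge_1_nat[OF B(2)[OF that]] by simp
    moreover have "0 \<le> 1 / real (m k)"
      by simp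
    then have "- (1 / 2 + 1 / real (m k)) \<le> 0"
      by linarith
    ultimately have "real p powr - (1 / 2 + 1 / real (m k)) \<le> real p powr 0"
      by (intro powr_mono)
    then show ?thesis
      using \<open>1 \<le> real p\<close> by (simp add: a_def)
  qed
  define X where "X k \<omega> = (\<Sum>p\<in>B k. log_euler_approx (a k p) (f p \<omega>))" for k \<omega>
  have "AE \<omega> in M. infinite {k. K * sqrt (V (z k) (m k)) \<le> X k \<omega>}"
  proof (rule AE_infinite_of_indep_events)
    show "indep_events (\<lambda>k. {\<omega>\<in>space M. K * sqrt (V (z k) (m k)) \<le> X k \<omega>}) UNIV"
      unfolding X_def using assms(2) disj B(2) by (rule steinhaus_indep_blocks) measurable
    show "exp (- (4 * (16 * (K + 1))\<^sup>2)) / 4 \<le> prob {\<omega>\<in>space M. K * sqrt (V (z k) (m k)) \<le> X k \<omega>}" for k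
      unfolding X_def V_eq
      using assms(3) V_ge[of k, unfolded V_eq] B a
      by (intro steinhaus_large_deviation[OF assms(2)]) (auto simp: K_def)
  qed simp
  moreover
  \<comment> \<open>The deterministic inequality is stated for all \<open>g\<close>, so that the
    cutoffs \<open>N k\<close> can be chosen before any sample point is fixed.\<close>
  define bound where "bound k n \<longleftrightarrow> (\<forall>g B. (\<forall>p. prime p \<longrightarrow> norm (g p) = 1) \<longrightarrow>
    (\<forall>n\<in>{1..y k}. norm (weighted_sum g (real n)) \<le> B) \<longrightarrow> 0 \<le> B \<longrightarrow>
    norm (\<Prod>p\<in>primes_le (y k). 1 / (1 - g p * of_real (a k p)))
      \<le> 1 + B + abel_remainder (1 / real (m k)) (y k) n g)" for k n
  have "\<exists>n\<ge>y k. bound k n" for k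
    unfolding bound_def a_def using m_pos[of k] by (intro norm_euler_product_le) simp
  then have "\<forall>k. \<exists>n. y k \<le> n \<and> bound k n"
    by blast
  from choice[OF this] obtain N where N: "\<And>k. y k \<le> N k" "\<And>k. bound k (N k)"
    by blast
  have "AE \<omega> in M. eventually (\<lambda>k. abel_remainder (1 / real (m k)) (y k) (N k) (\<lambda>p. f p \<omega>) < 1) sequentially"
    using AE_abel_remainder_less_1[OF assms(2) m_pos small N(1)[unfolded y_def]] by (simp add: y_def)
  ultimately have "AE \<omega> in M. Limsup at_top (\<lambda>T. ereal (cmod (weighted_sum (\<lambda>p. f p \<omega>) T) /
        exp (L * sqrt (ln (ln T))))) \<ge> 1"
    using steinhaus_AE_norm[OF assms(2)]
  proof eventually_elim
    case (elim \<omega>)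
    let ?g = "\<lambda>p. f p \<omega>"
    show ?case
    proof (rule limsup_ge_one[OF assms(3)])
      fix k0
      from elim(2) obtain k1 where k1: "\<And>k. k \<ge> k1 \<Longrightarrow> abel_remainder (1 / real (m k)) (y k) (N k) ?g < 1"
        by (auto simp: eventually_sequentially)
      from elim(1) obtain k where k: "k \<ge> max k0 k1" "K * sqrt (V (z k) (m k)) \<le> X k \<omega>"
        unfolding infinite_nat_iff_unbounded_le mem_Collect_eq by blast
      let ?F = "\<Prod>p\<in>primes_le (y k). 1 / (1 - ?g p * of_real (a k p))"
      have "X k \<omega> - c - real (z k) \<le> ln (norm ?F)"
        unfolding X_def B_def a_def c_def using elim(3) z_le by (intro log_euler_product_ge) auto
      with k(2) have ln_F: "K * sqrt (V (z k) (m k)) - c - real (z k) \<le> ln (norm ?F)"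
        by linarith
      have norm_lt: "norm (?g p * of_real (a k p)) < 1" if "prime p" for p
      proof -
        have "0 \<le> 1 / real (m k)"
          by simp
        then have "- (1 / 2 + 1 / real (m k)) < 0"
          by linarith
        then have "a k p < 1"
          unfolding a_def using prime_gt_1_nat[OF that] by (intro powr_less_one) auto
        then show ?thesis
          using elim(3) that by (simp add: norm_mult a_def[of k p])
      qed
      have "1 - ?g p * of_real (a k p) \<noteq> 0" if "prime p" for p
      proof
        assume "1 - ?g p * of_real (a k p) = 0"
        then have "?g p * of_real (a k p) = 1"
          by simp
        with norm_lt[OF that] show False
          by simp
      qed
      then have "norm ?F > 0"
        unfolding zero_less_norm_iff prod_zero_iff[OF finite_primes_le] by (auto simp: primes_le_def)
      then have "exp (K * sqrt (V (z k) (m k)) - c - real (z k)) \<le> norm ?F"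
        using ln_F by (simp add: ln_ge_iff)
      with large[of k] have F: "2 + exp (2 * L * sqrt (ln (real (m k)))) \<le> norm ?F"
        by linarith
      \<comment> \<open>If all sums up to \<open>y k\<close> were at most
        \<open>E = exp (2 * L * sqrt (ln (m k)))\<close>, the product would have norm less than
        \<open>2 + E\<close>, as the remainder is below 1. This contradicts
        \<open>F\<close>.\<close>
      have "\<exists>n\<in>{1..y k}. exp (2 * L * sqrt (ln (real (m k)))) < norm (weighted_sum ?g (real n))"
      proof (rule ccontr)
        assume "\<not> ?thesis"
        then have "norm ?F \<le> 1 + exp (2 * L * sqrt (ln (real (m k)))) + abel_remainder (1 / real (m k)) (y k) (N k) ?g"
          using N(2)[of k] elim(3) unfolding bound_def by (auto simp: not_less)
        with F k1[of k] k(1) show False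
          by simp
      qed
      then show "\<exists>m\<ge>k0. \<exists>n\<in>{1..2 ^ (m ^ 2)}. exp (2 * L * sqrt (ln (real m))) < norm (weighted_sum ?g (real n))"
        using k(1) k_le[of k] by (intro exI[of _ "m k"]) (auto simp: y_def)
    qed
  qed
  then show ?thesis
    by (intro exI[of _ "\<lambda>_. 0"]) simp
qed

end
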